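(* Let $K$ be an infinite field with $\mathrm{char}(K)\neq 2$, and let $T_{\mathrm{Sca}}(UJ_2)\subseteq J(X)$ be the set of all $\mathbb{Z}_2$-graded polynomial identities of $UJ_2=UJ_2(K)$ endowed with the scalar grading. Let $I$ be the $T_{\mathbb{Z}_2}$-ideal of $J(X)$ generated by the polynomials \[(y_1,y_2,y_3),\quad (z_1,y_1,y_2),\quad (y_1,z_1,z_2),\quad z_1(z_2,z_3,z_4).\] Then $I=T_{\mathrm{Sca}}(UJ_2)$. Moreover, let $S\subseteq J(X)$ be the set of all polynomials of the forms (a) $Y'Z'$, (b) $Y'(z_{i_0}Z')$, where $Y'=y_1^{k_1}\cdots y_r^{k_r}$ with $r\geq 0$ and $k_i\geq 0$ for all $i$; $Z'=(z_{i_1}z_{j_1})(z_{i_2}z_{j_2})\cdots(z_{i_t}z_{j_t})$ with $t\geq 0$ and $i_1\leq j_1\leq i_2\leq j_2\leq\cdots\leq i_t\leq j_t$; and $i_0\geq 1$. Then the elements $g+I$, $g\in S$, form a basis of the quotient vector space $J(X)/I$.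
   Context: $UT_2(K)$ is the associative algebra of $2\times 2$ upper triangular matrices over $K$ with usual product $\cdot$, and $UJ_2=UJ_2(K)$ is the same vector space with the Jordan product $u\circ v=\frac12(u\cdot v+v\cdot u)$, written $uv$. A $\mathbb{Z}_2$-grading is a decomposition $UJ_2=(UJ_2)_0\oplus (UJ_2)_1$ with $(UJ_2)_i\circ(UJ_2)_j\subseteq (UJ_2)_{i+j}$. The scalar grading is $(UJ_2)_0=\mathrm{span}\{e_{11}+e_{22}\}$, $(UJ_2)_1=\mathrm{span}\{e_{11}-e_{22},e_{12}\}$, where $e_{ij}$ are matrix units. $Y=\{y_1,y_2,\ldots\}$ and $Z=\{z_1,z_2,\ldots\}$ are disjoint infinite sets, $X=Y\cup Z$, and $J(X)$ is the free (unital) Jordan algebra over $K$ freely generated by $X$, with the $\mathbb{Z}_2$-grading in which each $y_i$ is even (degree $0$), each $z_i$ is odd (degree $1$), and the degree of a product of monomials is the sum of the degrees modulo $2$. A $T_{\mathbb{Z}_2}$-ideal is an ideal of $J(X)$ closed under all $\mathbb{Z}_2$-graded endomorphisms of $J(X)$; the $T_{\mathbb{Z}_2}$-ideal generated by a set is the smallest one containing it. An element $f(y_1,\ldots,y_s,z_1,\ldots,z_n)\in J(X)$ is a $\mathbb{Z}_2$-graded polynomial identity of $UJ_2$ if it vanishes under all substitutions of elements of $(UJ_2)_0$ for the $y_i$ and of elements of $(UJ_2)_1$ for the $z_i$. Associator: $(u,v,w)=(uv)w-u(vw)$. Products and powers without parentheses are left-normed: $f_1f_2\cdots f_n=(f_1\cdots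 f_{n-1})f_n$ (in $Z'$ the factors are the pairs $(z_{i_m}z_{j_m})$); the empty product is $1$. *)

theory Defs
  imports
    "HOL-Analysis.Finite_Cartesian_Product"
    "HOL-Analysis.Cartesian_Space"
    "HOL-Library.Z2"
    "HOL.Hull"
begin

section \<open>The free unital Jordan algebra on $X = Y \cup Z$\<close>

text \<open>
  The variables are indexed from 0: \<open>Y i\<close> and \<open>Z i\<close> stand for $y_{i+1}$ and $z_{i+1}$.
\<close>

datatype var = Y nat | Z nat

text \<open>
  The free algebra of the variety of unital (linear) Jordan algebras is the algebra of terms over
  the variables modulo the congruence generated by the defining laws of the variety: the axioms of
  a vector space, bilinearity, commutativity, the unit law and the Jordan identity
  $(x^2 y) x = x^2 (y x)$.
\<close>

datatype 'k jterm =
    Var var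
  | Zero
  | One
  | Add "'k jterm" "'k jterm"
  | Scale 'k "'k jterm"
  | Mul "'k jterm" "'k jterm"

inductive jeq :: "'k::field jterm \<Rightarrow> 'k jterm \<Rightarrow> bool" where
  refl: "jeq s s"
| sym: "jeq s t \<Longrightarrow> jeq t s"
| trans: "jeq s t \<Longrightarrow> jeq t u \<Longrightarrow> jeq s u"
| cong_Add: "jeq s s' \<Longrightarrow> jeq t t' \<Longrightarrow> jeq (Add s t) (Add s' t')"
| cong_Scale: "jeq s s' \<Longrightarrow> jeq (Scale a s) (Scale a s')"
| cong_Mul: "jeq s s' \<Longrightarrow> jeq t t' \<Longrightarrow> jeq (Mul s t) (Mul s' t')"
| add_assoc: "jeq (Add (Add s t) u) (Add s (Add t u))"
| add_comm: "jeq (Add s t) (Add t s)"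
| add_Zero: "jeq (Add Zero s) s"
| add_inverse: "jeq (Add (Scale (- 1) s) s) Zero"
| scale_Add: "jeq (Scale a (Add s t)) (Add (Scale a s) (Scale a t))"
| scale_plus: "jeq (Scale (a + b) s) (Add (Scale a s) (Scale b s))"
| scale_mult: "jeq (Scale (a * b) s) (Scale a (Scale b s))"
| scale_one: "jeq (Scale 1 s) s"
| mul_Add: "jeq (Mul (Add s t) u) (Add (Mul s u) (Mul t u))"
| mul_Scale: "jeq (Mul (Scale a s) t) (Scale a (Mul s t))"
| mul_comm: "jeq (Mul s t) (Mul t s)"
| mul_One: "jeq (Mul One s) s"
| jordan: "jeq (Mul (Mul (Mul s s) t) s) (Mul (Mul s s) (Mul t s))"

quotient_type (overloaded) 'k free_jordan = "'k::field jterm" / jeq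
  by (rule equivpI) (auto simp: reflp_def symp_def transp_def intro: jeq.intros)

text \<open>
  The additive structure is put into the class \<open>ab_group_add\<close>; the (non-associative) product
  only inhabits the syntactic class \<open>times\<close>.
\<close>

instantiation free_jordan :: (field) "{ab_group_add, one, times}"
begin

lift_definition zero_free_jordan :: "'a free_jordan" is Zero .
lift_definition one_free_jordan :: "'a free_jordan" is One .
lift_definition plus_free_jordan :: "'a free_jordan \<Rightarrow> 'a free_jordan \<Rightarrow> 'a free_jordan" is Add
  by (rule cong_Add)
lift_definition uminus_free_jordan :: "'a free_jordan \<Rightarrow> 'a free_jordan" is "Scale (- 1)"
  by (rule cong_Scale)
lift_definition times_free_jordan :: "'a free_jordan \<Rightarrow> 'a free_jordan \<Rightarrow> 'a free_jordan" is Mul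
  by (rule cong_Mul)
definition minus_free_jordan :: "'a free_jordan \<Rightarrow> 'a free_jordan \<Rightarrow> 'a free_jordan" where
  "f - g = f + (- g)" for f g :: "'a free_jordan"

instance
proof
  fix f g h :: "'a free_jordan"
  show "f + g + h = f + (g + h)" by transfer (rule add_assoc)
  show "f + g = g + f" by transfer (rule add_comm)
  show "0 + f = f" by transfer (rule add_Zero)
  show "- f + f = 0" by transfer (rule add_inverse)
  show "f - g = f + (- g)" by (rule minus_free_jordan_def)
qed

end

lift_definition jscale :: "'k::field \<Rightarrow> 'k free_jordan \<Rightarrow> 'k free_jordan" is Scale
  by (rule cong_Scale)

lift_definition jvar :: "var \<Rightarrow> 'k::field free_jordan" is Var .

abbreviation y :: "nat \<Rightarrow> 'k::field free_jordan" where "y i \<equiv> jvar (Y i)"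
abbreviation z :: "nat \<Rightarrow> 'k::field free_jordan" where "z i \<equiv> jvar (Z i)"

interpretation J: vector_space "jscale :: 'k::field \<Rightarrow> 'k free_jordan \<Rightarrow> 'k free_jordan"
proof
  fix a b :: 'k and f g :: "'k free_jordan"
  show "jscale a (f + g) = jscale a f + jscale a g" by transfer (rule scale_Add)
  show "jscale (a + b) f = jscale a f + jscale b f" by transfer (rule scale_plus)
  show "jscale a (jscale b f) = jscale (a * b) f" by transfer (rule jeq.sym, rule scale_mult)
  show "jscale 1 f = f" by transfer (rule scale_one)
qed

lemma free_jordan_laws:
  fixes f g h :: "'k::field free_jordan"
  shows "(f + g) * h = f * h + g * h"
    and "jscale a f * g = jscale a (f * g)"
    and "f * g = g * f"
    and "1 * f = f"
    and "((f * f) * g) * f = (f * f) * (g * f)"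
  by (transfer, rule mul_Add mul_Scale mul_comm mul_One jordan)+

definition associator :: "'k::field free_jordan \<Rightarrow> 'k free_jordan \<Rightarrow> 'k free_jordan \<Rightarrow> 'k free_jordan"
  where "associator u v w = (u * v) * w - u * (v * w)"

section \<open>The grading of the free algebra and $T_{\mathbb{Z}_2}$-ideals\<close>

fun var_degree :: "var \<Rightarrow> bit" where
  "var_degree (Y i) = 0"
| "var_degree (Z i) = 1"

inductive monomial :: "'k::field free_jordan \<Rightarrow> bit \<Rightarrow> bool" where
  one: "monomial 1 0"
| var: "monomial (jvar x) (var_degree x)"
| mult: "monomial u c \<Longrightarrow> monomial v d \<Longrightarrow> monomial (u * v) (c + d)"

definition homogeneous :: "bit \<Rightarrow> 'k::field free_jordan set" where
  "homogeneous d = J.span {m. monomial m d}"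

definition graded_endomorphism :: "('k::field free_jordan \<Rightarrow> 'k free_jordan) \<Rightarrow> bool" where
  "graded_endomorphism \<phi> \<longleftrightarrow>
     Vector_Spaces.linear jscale jscale \<phi> \<and>
     \<phi> 1 = 1 \<and>
     (\<forall>f g. \<phi> (f * g) = \<phi> f * \<phi> g) \<and>
     (\<forall>d. \<phi> ` homogeneous d \<subseteq> homogeneous d)"

definition T_ideal :: "'k::field free_jordan set \<Rightarrow> bool" where
  "T_ideal I \<longleftrightarrow>
     J.subspace I \<and>
     (\<forall>f\<in>I. \<forall>g. f * g \<in> I \<and> g * f \<in> I) \<and>
     (\<forall>\<phi>. graded_endomorphism \<phi> \<longrightarrow> \<phi> ` I \<subseteq> I)"

lemma T_ideal_hull: "T_ideal (T_ideal hull G)" for G :: "'k::field free_jordan set"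
proof (rule hull_in)
  fix T :: "'k free_jordan set set"
  assume *: "\<forall>A\<in>T. T_ideal A"
  then have "J.subspace (\<Inter>T)"
    by (intro J.subspace_Inter) (auto simp: T_ideal_def)
  with * show "T_ideal (\<Inter>T)"
    unfolding T_ideal_def by (auto simp: image_subset_iff)
qed

section \<open>The Jordan algebra $UJ_2(K)$ with the scalar grading\<close>

type_synonym 'k mat2 = "'k^2^2"

definition mscale :: "'k::field \<Rightarrow> 'k mat2 \<Rightarrow> 'k mat2" where
  "mscale c A = (\<chi> i j. c * A $ i $ j)"

interpretation M: vector_space "mscale :: 'k::field \<Rightarrow> 'k mat2 \<Rightarrow> 'k mat2"
  by standard (auto simp: mscale_def vec_eq_iff algebra_simps)

definition matrix_unit :: "2 \<Rightarrow> 2 \<Rightarrow> 'k::field mat2" where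
  "matrix_unit i j = (\<chi> k l. if k = i \<and> l = j then 1 else 0)"

definition UJ2 :: "'k::field mat2 set" where
  "UJ2 = {A. A $ 2 $ 1 = 0}"

definition jprod :: "'k::field mat2 \<Rightarrow> 'k mat2 \<Rightarrow> 'k mat2" (infixl \<open>\<circ>\<^sub>J\<close> 70) where
  "A \<circ>\<^sub>J B = mscale (1 / 2) (A ** B + B ** A)"

definition UJ2_Sca :: "bit \<Rightarrow> 'k::field mat2 set" where
  "UJ2_Sca d =
     (if d = 0 then M.span {matrix_unit 1 1 + matrix_unit 2 2}
      else M.span {matrix_unit 1 1 - matrix_unit 2 2, matrix_unit 1 2})"

text \<open>
  Substitution of matrices for the variables is evaluation of a representing term; it does not
  depend on the choice of the term because the Jordan product satisfies all the laws above as soon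
  as the characteristic is not 2 (lemma \<open>subst_eq\<close>).
\<close>

primrec term_subst :: "(var \<Rightarrow> 'k mat2) \<Rightarrow> 'k::field jterm \<Rightarrow> 'k mat2" where
  "term_subst \<rho> (Var x) = \<rho> x"
| "term_subst \<rho> Zero = 0"
| "term_subst \<rho> One = mat 1"
| "term_subst \<rho> (Add s t) = term_subst \<rho> s + term_subst \<rho> t"
| "term_subst \<rho> (Scale a s) = mscale a (term_subst \<rho> s)"
| "term_subst \<rho> (Mul s t) = term_subst \<rho> s \<circ>\<^sub>J term_subst \<rho> t"

definition subst :: "(var \<Rightarrow> 'k mat2) \<Rightarrow> 'k::field free_jordan \<Rightarrow> 'k mat2" where
  "subst \<rho> f = term_subst \<rho> (rep_free_jordan f)"

lemma jprod_nth:
  "(A \<circ>\<^sub>J B) $ i $ j = (1/2) * (A$i$1 * B$1$j + A$i$2 * B$2$j + (B$i$1 * A$1$j + B$i$2 * A$2$j))"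
  by (simp add: jprod_def mscale_def matrix_matrix_mult_def sum_2)

lemma jprod_laws:
  fixes A B C :: "'k::field mat2"
  shows "(A + B) \<circ>\<^sub>J C = A \<circ>\<^sub>J C + B \<circ>\<^sub>J C"
    and "mscale a A \<circ>\<^sub>J B = mscale a (A \<circ>\<^sub>J B)"
    and "A \<circ>\<^sub>J B = B \<circ>\<^sub>J A"
    and "(2::'k) \<noteq> 0 \<Longrightarrow> mat 1 \<circ>\<^sub>J A = A"
    and "((A \<circ>\<^sub>J A) \<circ>\<^sub>J B) \<circ>\<^sub>J A = (A \<circ>\<^sub>J A) \<circ>\<^sub>J (B \<circ>\<^sub>J A)"
proof -
  show "(A + B) \<circ>\<^sub>J C = A \<circ>\<^sub>J C + B \<circ>\<^sub>J C"
    by (simp add: vec_eq_iff jprod_nth algebra_simps)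
  show "mscale a A \<circ>\<^sub>J B = mscale a (A \<circ>\<^sub>J B)"
    by (simp add: vec_eq_iff jprod_nth mscale_def algebra_simps)
  show "A \<circ>\<^sub>J B = B \<circ>\<^sub>J A"
    by (simp add: jprod_def add.commute)
  show "mat 1 \<circ>\<^sub>J A = A" if "(2::'k) \<noteq> 0"
    using that by (simp add: jprod_def vec_eq_iff mscale_def)
  define h where "h = 1 / (2::'k)"
  have *: "(A \<circ>\<^sub>J B) $ i $ j = h * (A$i$1 * B$1$j + A$i$2 * B$2$j + (B$i$1 * A$1$j + B$i$2 * A$2$j))"
    for A B :: "'k mat2" and i j by (simp add: jprod_nth h_def)
  show "((A \<circ>\<^sub>J A) \<circ>\<^sub>J B) \<circ>\<^sub>J A = (A \<circ>\<^sub>J A) \<circ>\<^sub>J (B \<circ>\<^sub>J A)"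
    unfolding vec_eq_iff forall_2 * by (intro conjI; algebra)
qed

lemma mem_UJ2_Sca:
  fixes A :: "'k::field mat2"
  shows "A \<in> UJ2_Sca 0 \<longleftrightarrow> A $ 1 $ 1 = A $ 2 $ 2 \<and> A $ 1 $ 2 = 0 \<and> A $ 2 $ 1 = 0"
    and "A \<in> UJ2_Sca 1 \<longleftrightarrow> A $ 1 $ 1 = - A $ 2 $ 2 \<and> A $ 2 $ 1 = 0"
proof -
  have "A = mscale (A $ 1 $ 1) (matrix_unit 1 1 + matrix_unit 2 2)"
    if "A $ 1 $ 1 = A $ 2 $ 2" "A $ 1 $ 2 = 0" "A $ 2 $ 1 = 0"
    using that by (simp add: vec_eq_iff forall_2 mscale_def matrix_unit_def)
  then show "A \<in> UJ2_Sca 0 \<longleftrightarrow> A $ 1 $ 1 = A $ 2 $ 2 \<and> A $ 1 $ 2 = 0 \<and> A $ 2 $ 1 = 0"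
    unfolding UJ2_Sca_def
    by (auto simp: M.span_singleton mscale_def matrix_unit_def)
  have "A - mscale (A $ 1 $ 1) (matrix_unit 1 1 - matrix_unit 2 2) =
        mscale (A $ 1 $ 2) (matrix_unit 1 2)"
    if "A $ 1 $ 1 = - A $ 2 $ 2" "A $ 2 $ 1 = 0"
    using that by (simp add: vec_eq_iff forall_2 mscale_def matrix_unit_def)
  moreover have "A $ 1 $ 1 = - A $ 2 $ 2 \<and> A $ 2 $ 1 = 0"
    if "A - mscale k (matrix_unit 1 1 - matrix_unit 2 2) = mscale l (matrix_unit 1 2)" for k l
    using that by (simp add: vec_eq_iff forall_2 mscale_def matrix_unit_def eq_neg_iff_add_eq_0 add.commute)
  moreover have "A \<in> UJ2_Sca 1 \<longleftrightarrow> (\<exists>k l. A - mscale k (matrix_unit 1 1 - matrix_unit 2 2) =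
      mscale l (matrix_unit 1 2))"
    by (auto simp: UJ2_Sca_def M.span_insert[of "matrix_unit 1 1 - matrix_unit 2 2"] M.span_singleton)
  ultimately show "A \<in> UJ2_Sca 1 \<longleftrightarrow> A $ 1 $ 1 = - A $ 2 $ 2 \<and> A $ 2 $ 1 = 0"
    by blast
qed

lemma UJ2_Sca_grading:
  assumes "(2::'k::field) \<noteq> 0"
  shows "(UJ2 :: 'k mat2 set) = {A + B | A B. A \<in> UJ2_Sca 0 \<and> B \<in> UJ2_Sca 1}"
    and "UJ2_Sca 0 \<inter> UJ2_Sca 1 = {0 :: 'k mat2}"
    and "A \<in> UJ2_Sca c \<Longrightarrow> B \<in> UJ2_Sca d \<Longrightarrow> (A \<circ>\<^sub>J B :: 'k mat2) \<in> UJ2_Sca (c + d)"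
proof -
  have eq0: "a = 0" if "a = - a" for a :: 'k
  proof -
    have "2 * a = 0" using that by (metis add.right_inverse mult_2)
    then show ?thesis using assms by simp
  qed
  show "(UJ2 :: 'k mat2 set) = {A + B | A B. A \<in> UJ2_Sca 0 \<and> B \<in> UJ2_Sca 1}"
  proof (intro equalityI subsetI)
    fix A :: "'k mat2" assume "A \<in> UJ2"
    define s where "s = (A $ 1 $ 1 + A $ 2 $ 2) / 2"
    have "A = mat s + (A - mat s)" by simp
    moreover have "mat s \<in> UJ2_Sca 0" by (simp add: mem_UJ2_Sca mat_def)
    moreover have "A - mat s \<in> UJ2_Sca 1"
      using \<open>A \<in> UJ2\<close> assms by (simp add: mem_UJ2_Sca mat_def UJ2_def s_def field_simps)
    ultimately show "A \<in> {A + B | A B. A \<in> UJ2_Sca 0 \<and> B \<in> UJ2_Sca 1}" by blast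
  qed (auto simp: mem_UJ2_Sca UJ2_def)
  show "UJ2_Sca 0 \<inter> UJ2_Sca 1 = {0 :: 'k mat2}"
    using assms by (auto simp: mem_UJ2_Sca vec_eq_iff forall_2 intro: eq0)
  show "A \<in> UJ2_Sca c \<Longrightarrow> B \<in> UJ2_Sca d \<Longrightarrow> (A \<circ>\<^sub>J B :: 'k mat2) \<in> UJ2_Sca (c + d)"
    by (cases c; cases d) (auto simp: mem_UJ2_Sca jprod_nth)
qed

lemma subst_eq:
  assumes "(2::'k::field) \<noteq> 0"
  shows "subst \<rho> (abs_free_jordan t) = term_subst (\<rho> :: var \<Rightarrow> 'k mat2) t"
proof -
  have "jeq s t \<Longrightarrow> term_subst \<rho> s = term_subst \<rho> t" for s t
  proof (induction rule: jeq.induct)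
    case (mul_comm s t)
    show ?case by (simp add: jprod_laws(3)[of "term_subst \<rho> s"])
  qed (use assms in \<open>simp_all add: jprod_laws(1,2,4,5) M.scale_right_distrib M.scale_left_distrib\<close>)
  moreover have "jeq (rep_free_jordan (abs_free_jordan t)) t"
    by (rule rep_abs_rsp_left[OF Quotient3_free_jordan]) (rule jeq.refl)
  ultimately show ?thesis by (simp add: subst_def)
qed

definition T_Sca :: "'k::field free_jordan set" where
  "T_Sca = {f. \<forall>\<rho>. (\<forall>i. \<rho> (Y i) \<in> UJ2_Sca 0) \<and> (\<forall>i. \<rho> (Z i) \<in> UJ2_Sca 1) \<longrightarrow> subst \<rho> f = 0}"

section \<open>The ideal $I$ and the quotient space $J(X)/I$\<close>

definition I_Sca :: "'k::field free_jordan set" where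
  "I_Sca = T_ideal hull
     {associator (y 0) (y 1) (y 2),
      associator (z 0) (y 0) (y 1),
      associator (y 0) (z 0) (z 1),
      z 0 * associator (z 1) (z 2) (z 3)}"

lemma subspace_I_Sca: "J.subspace (I_Sca :: 'k::field free_jordan set)"
  using T_ideal_hull unfolding I_Sca_def T_ideal_def by blast

quotient_type (overloaded) 'k quot_Sca = "'k::field free_jordan" / "\<lambda>f g. f - g \<in> I_Sca"
proof (rule equivpI)
  show "reflp (\<lambda>f g :: 'k free_jordan. f - g \<in> I_Sca)"
    by (simp add: reflp_def J.subspace_0 subspace_I_Sca)
  show "symp (\<lambda>f g :: 'k free_jordan. f - g \<in> I_Sca)"
    using J.subspace_neg[OF subspace_I_Sca] by (fastforce simp: symp_def)
  show "transp (\<lambda>f g :: 'k free_jordan. f - g \<in> I_Sca)"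
    using J.subspace_add[OF subspace_I_Sca] by (fastforce simp: transp_def)
qed

instantiation quot_Sca :: (field) ab_group_add
begin

lift_definition zero_quot_Sca :: "'a quot_Sca" is 0 .
lift_definition plus_quot_Sca :: "'a quot_Sca \<Rightarrow> 'a quot_Sca \<Rightarrow> 'a quot_Sca" is "(+)"
  unfolding add_diff_add by (rule J.subspace_add[OF subspace_I_Sca])
lift_definition uminus_quot_Sca :: "'a quot_Sca \<Rightarrow> 'a quot_Sca" is uminus
  unfolding minus_diff_minus by (rule J.subspace_neg[OF subspace_I_Sca])
lift_definition minus_quot_Sca :: "'a quot_Sca \<Rightarrow> 'a quot_Sca \<Rightarrow> 'a quot_Sca" is "(-)"
proof -
  fix f f' g g' :: "'a free_jordan"
  assume "f - f' \<in> I_Sca" "g - g' \<in> I_Sca"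
  then have "(f - f') - (g - g') \<in> I_Sca" by (rule J.subspace_diff[OF subspace_I_Sca])
  then show "(f - g) - (f' - g') \<in> I_Sca" by (simp add: algebra_simps)
qed

instance
  by (standard; transfer) (simp_all add: J.subspace_0 subspace_I_Sca)

end

lift_definition qscale :: "'k::field \<Rightarrow> 'k quot_Sca \<Rightarrow> 'k quot_Sca" is jscale
  unfolding J.scale_right_diff_distrib[symmetric] by (rule J.subspace_scale[OF subspace_I_Sca])

interpretation Q: vector_space "qscale :: 'k::field \<Rightarrow> 'k quot_Sca \<Rightarrow> 'k quot_Sca"
  by (standard; transfer)
     (simp_all add: J.subspace_0 subspace_I_Sca J.scale_right_distrib J.scale_left_distrib)

definition coset :: "'k::field free_jordan \<Rightarrow> 'k quot_Sca" where
  "coset f = abs_quot_Sca f"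

lemma coset_simps:
  fixes f g :: "'k::field free_jordan"
  shows "coset f = coset g \<longleftrightarrow> f - g \<in> I_Sca"
    and "surj (coset :: 'k free_jordan \<Rightarrow> 'k quot_Sca)"
    and "coset (f + g) = coset f + coset g"
    and "coset (jscale a f) = qscale a (coset f)"
proof -
  show "surj (coset :: 'k free_jordan \<Rightarrow> 'k quot_Sca)"
    unfolding surj_def coset_def by (rule allI, rule quot_Sca.abs_induct, rule exI, rule HOL.refl)
qed (simp_all add: coset_def quot_Sca.abs_eq_iff plus_quot_Sca.abs_eq qscale.abs_eq)

section \<open>The set $S$\<close>

text \<open>Left-normed products; the leading unit makes the empty product equal to 1.\<close>

definition left_normed :: "'k::field free_jordan list \<Rightarrow> 'k free_jordan" where
  "left_normed fs = foldl (*) 1 fs"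

text \<open>The list \<open>ks\<close> holds the exponents of the first \<open>r = length ks\<close> even variables.\<close>

definition Y_prod :: "nat list \<Rightarrow> 'k::field free_jordan" where
  "Y_prod ks = left_normed (map (\<lambda>i. left_normed (replicate (ks ! i) (y i))) [0..<length ks])"

definition Z_prod :: "(nat \<times> nat) list \<Rightarrow> 'k::field free_jordan" where
  "Z_prod ps = left_normed (map (\<lambda>(i, j). z i * z j) ps)"

definition index_sorted :: "(nat \<times> nat) list \<Rightarrow> bool" where
  "index_sorted ps \<longleftrightarrow> sorted (concat (map (\<lambda>(i, j). [i, j]) ps))"

definition S_Sca :: "'k::field free_jordan set" where
  "S_Sca = {Y_prod ks * Z_prod ps | ks ps. index_sorted ps} \<union>
           {Y_prod ks * (z i * Z_prod ps) | ks i ps. index_sorted ps}"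

end

theory Submission
  imports Defs "HOL-Library.Multiset" "HOL-Computational_Algebra.Polynomial"
begin

text \<open>
  Modulo \<open>I\<close> the even part of $J(X)$ is commutative and associative, the odd part is a module over it,
  and the product of odd elements is bilinear over the even part. By commutativity the fourth generator then
  becomes $(ab)(cd) = (ac)(bd)$ for odd $a, b, c, d$, so a product of pairs of odd elements is symmetric
  in all its factors and \<open>S\<close> spans.

  Conversely, evaluate at $y_i \mapsto t_i$ and $z_i \mapsto \alpha_i(e_{11}-e_{22}) + \beta_i e_{12}$,
  with product $\alpha_i\alpha_j$ of the values of $z_i$ and $z_j$. A suitable linear functional sends the
  elements of \<open>S\<close> to distinct monomials in $t, \alpha, \beta$; over an infinite field these are
  distinct characters of a multiplicative monoid and hence independent. So \<open>S\<close> is independent modulo the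
  identities, which also forces every identity into \<open>I\<close>.
\<close>

section \<open>Algebra in $J(X)$\<close>

lemma free_jordan_distrib_left: "f * (g + h) = f * g + f * h" for f g h :: "'k::field free_jordan"
  using free_jordan_laws(1)[of g h f] by (simp add: free_jordan_laws(3))

lemma free_jordan_scale_right: "f * jscale a g = jscale a (f * g)" for f g :: "'k::field free_jordan"
  using free_jordan_laws(2)[of a g f] by (simp add: free_jordan_laws(3))

lemma free_jordan_minus_left: "(f - g) * h = f * h - g * h" for f g h :: "'k::field free_jordan"
  using free_jordan_laws(1)[of "f - g" g h] by (simp add: algebra_simps)

lemma free_jordan_minus_right: "h * (f - g) = h * f - h * g" for f g h :: "'k::field free_jordan"
  using free_jordan_distrib_left[of h "f - g" g] by (simp add: algebra_simps)

lemma free_jordan_zero: "0 * f = 0" "f * 0 = 0" for f :: "'k::field free_jordan"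
  using free_jordan_minus_left[of 0 0 f] free_jordan_minus_right[of f 0 0] by simp_all

lemma free_jordan_unit_right: "f * 1 = f" for f :: "'k::field free_jordan"
  using free_jordan_laws(3,4) by metis

text \<open>Every class has a representing term, so this is structural induction on terms pushed
  through the quotient.\<close>

lemma free_jordan_induct [case_names var zero one add scale mult]:
  fixes f :: "'k::field free_jordan"
  assumes "\<And>x. P (jvar x)" "P 0" "P 1" "\<And>f g. P f \<Longrightarrow> P g \<Longrightarrow> P (f + g)"
    "\<And>a f. P f \<Longrightarrow> P (jscale a f)" "\<And>f g. P f \<Longrightarrow> P g \<Longrightarrow> P (f * g)"
  shows "P f"
proof -
  have "P (abs_free_jordan t)" for t
  proof (induction t)
    case (Var x) then show ?case using assms(1)[of x] by (simp add: jvar.abs_eq)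
  next
    case Zero then show ?case using assms(2) by (simp add: zero_free_jordan_def)
  next
    case One then show ?case using assms(3) by (simp add: one_free_jordan_def)
  next
    case (Add t u) then show ?case using assms(4) by (metis plus_free_jordan.abs_eq)
  next
    case (Scale a t) then show ?case using assms(5) by (metis jscale.abs_eq)
  next
    case (Mul t u) then show ?case using assms(6) by (metis times_free_jordan.abs_eq)
  qed
  then show ?thesis by (induction f rule: free_jordan.abs_induct) simp
qed

section \<open>Substitution endomorphisms of the free algebra\<close>

primrec term_hom :: "(var \<Rightarrow> 'k free_jordan) \<Rightarrow> 'k::field jterm \<Rightarrow> 'k free_jordan" where
  "term_hom \<theta> (Var x) = \<theta> x"
| "term_hom \<theta> Zero = 0"
| "term_hom \<theta> One = 1"
| "term_hom \<theta> (Add s t) = term_hom \<theta> s + term_hom \<theta> t"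
| "term_hom \<theta> (Scale a s) = jscale a (term_hom \<theta> s)"
| "term_hom \<theta> (Mul s t) = term_hom \<theta> s * term_hom \<theta> t"

text \<open>The universal property of $J(X)$: evaluation respects \<open>jeq\<close> because the
  target satisfies every law generating it.\<close>

lift_definition free_hom :: "(var \<Rightarrow> 'k free_jordan) \<Rightarrow> 'k::field free_jordan \<Rightarrow> 'k free_jordan"
  is term_hom
proof -
  fix \<theta> :: "var \<Rightarrow> 'k free_jordan" and s t :: "'k jterm"
  show "jeq s t \<Longrightarrow> term_hom \<theta> s = term_hom \<theta> t"
  proof (induction rule: jeq.induct)
    case (mul_comm s t)
    show ?case by (simp add: free_jordan_laws(3)[of "term_hom \<theta> s"])
  qed (simp_all add: free_jordan_laws(1,2,4,5) J.scale_right_distrib J.scale_left_distrib add.assoc add.commute)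
qed

lemma free_hom_simps:
  fixes \<theta> :: "var \<Rightarrow> 'k::field free_jordan"
  shows
  "free_hom \<theta> (jvar x) = \<theta> x"
  "free_hom \<theta> 1 = 1"
  "free_hom \<theta> (f + g) = free_hom \<theta> f + free_hom \<theta> g"
  "free_hom \<theta> (jscale a f) = jscale a (free_hom \<theta> f)"
  "free_hom \<theta> (f * g) = free_hom \<theta> f * free_hom \<theta> g"
proof -
  show "free_hom \<theta> (jvar x) = \<theta> x" by transfer simp
  show "free_hom \<theta> 1 = 1" by transfer simp
  show "free_hom \<theta> (f + g) = free_hom \<theta> f + free_hom \<theta> g" by transfer simp
  show "free_hom \<theta> (jscale a f) = jscale a (free_hom \<theta> f)" by transfer simp
  show "free_hom \<theta> (f * g) = free_hom \<theta> f * free_hom \<theta> g" by transfer simp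
qed

lemma linear_free_hom: "Vector_Spaces.linear jscale jscale (free_hom \<theta>)"
  by unfold_locales (simp_all add: free_hom_simps)

lemma free_hom_minus: "free_hom \<theta> (f - g) = free_hom \<theta> f - free_hom \<theta> g"
  using free_hom_simps(3)[of \<theta> "f - g" g] by (simp add: algebra_simps)

section \<open>Homogeneous components and graded endomorphisms\<close>

lemma subspace_homogeneous: "J.subspace (homogeneous d)"
  by (simp add: homogeneous_def)

lemma homogeneous_mult:
  assumes f: "f \<in> homogeneous c" and g: "g \<in> homogeneous d"
  shows "f * g \<in> homogeneous (c + d)"
proof -
  \<comment> \<open>Bilinear extension in two rounds: first in g with a monomial u on the left, then
    in f.\<close>
  have "u * g \<in> homogeneous (c + d)" if u: "monomial u c" for u
    using g unfolding homogeneous_def[of d]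
  proof (induction rule: J.span_induct_alt)
    case base show ?case by (simp add: free_jordan_zero J.subspace_0 subspace_homogeneous)
  next
    case (step a v g)
    have "u * v \<in> homogeneous (c + d)"
      unfolding homogeneous_def using monomial.mult[OF u] step.hyps by (intro J.span_base) simp
    then show ?case
      using step.IH by (simp add: free_jordan_distrib_left free_jordan_scale_right
          J.subspace_add J.subspace_scale subspace_homogeneous)
  qed
  with f show ?thesis unfolding homogeneous_def[of c]
  proof (induction rule: J.span_induct_alt)
    case base show ?case by (simp add: free_jordan_zero J.subspace_0 subspace_homogeneous)
  next
    case (step a v g)
    then show ?case by (simp add: free_jordan_laws(1,2)
          J.subspace_add J.subspace_scale subspace_homogeneous)
  qed
qed

lemma homogeneous_one: "1 \<in> homogeneous 0"
  unfolding homogeneous_def by (auto intro: J.span_base monomial.one)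

lemma homogeneous_var: "jvar x \<in> homogeneous (var_degree x)"
  unfolding homogeneous_def by (auto intro: J.span_base monomial.var)

lemma homogeneous_y: "y i \<in> homogeneous 0" and homogeneous_z: "z i \<in> homogeneous 1"
  using homogeneous_var[of "Y i"] homogeneous_var[of "Z i"] by simp_all

text \<open>A monomial is sent to the corresponding product of homogeneous elements, so the degrees
  of the images of the variables decide; linearity does the rest.\<close>

lemma graded_endomorphism_free_hom:
  assumes "\<And>x. \<theta> x \<in> homogeneous (var_degree x)"
  shows "graded_endomorphism (free_hom \<theta>)"
proof -
  have mono: "free_hom \<theta> m \<in> homogeneous d" if "monomial m d" for m d
    using that
  proof induction
    case (mult u c v d)
    then show ?case by (simp only: free_hom_simps homogeneous_mult)
  qed (simp_all add: free_hom_simps assms homogeneous_one)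
  have "free_hom \<theta> f \<in> homogeneous d" if "f \<in> homogeneous d" for f d
    using that unfolding homogeneous_def[of d]
  proof (induction rule: J.span_induct_alt)
    case base then show ?case
      using free_hom_minus[of \<theta> 0 0] by (simp add: J.span_zero)
  next
    case (step a m f)
    then show ?case using mono[of m d]
      by (simp add: free_hom_simps homogeneous_def J.span_add J.span_scale)
  qed
  then show ?thesis
    by (auto simp: graded_endomorphism_def linear_free_hom free_hom_simps)
qed

section \<open>The quotient algebra\<close>

lemma T_ideal_I_Sca: "T_ideal (I_Sca :: 'k::field free_jordan set)"
  unfolding I_Sca_def by (rule T_ideal_hull)

lemma I_Sca_mult:
  assumes "f \<in> I_Sca" shows "f * g \<in> I_Sca" "g * f \<in> I_Sca"
  using T_ideal_I_Sca assms unfolding T_ideal_def by blast+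

lemma I_Sca_graded_hom:
  assumes "f \<in> I_Sca" "\<And>x. \<theta> x \<in> homogeneous (var_degree x)"
  shows "free_hom \<theta> f \<in> I_Sca"
  using T_ideal_I_Sca assms(1) graded_endomorphism_free_hom[OF assms(2)]
  unfolding T_ideal_def by blast

lemma I_Sca_generators:
  "associator (y 0) (y 1) (y 2) \<in> I_Sca" "associator (z 0) (y 0) (y 1) \<in> I_Sca"
  "associator (y 0) (z 0) (z 1) \<in> I_Sca" "z 0 * associator (z 1) (z 2) (z 3) \<in> I_Sca"
  unfolding I_Sca_def by (rule hull_inc, simp)+

text \<open>The generators mention particular variables only; a graded substitution carries their
  membership in the ideal over to all homogeneous elements of matching degree.\<close>

lemma I_Sca_associators:
  shows "u \<in> homogeneous 0 \<Longrightarrow> v \<in> homogeneous 0 \<Longrightarrow> w \<in> homogeneous 0 \<Longrightarrow> associator u v w \<in> I_Sca"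
    and "u \<in> homogeneous 1 \<Longrightarrow> v \<in> homogeneous 0 \<Longrightarrow> w \<in> homogeneous 0 \<Longrightarrow> associator u v w \<in> I_Sca"
    and "u \<in> homogeneous 0 \<Longrightarrow> v \<in> homogeneous 1 \<Longrightarrow> w \<in> homogeneous 1 \<Longrightarrow> associator u v w \<in> I_Sca"
    and "t \<in> homogeneous 1 \<Longrightarrow> u \<in> homogeneous 1 \<Longrightarrow> v \<in> homogeneous 1 \<Longrightarrow> w \<in> homogeneous 1
      \<Longrightarrow> t * associator u v w \<in> I_Sca"
proof -
  have hom: "free_hom \<theta> (associator f g h) =
      associator (free_hom \<theta> f) (free_hom \<theta> g) (free_hom \<theta> h)" for \<theta> f g h
    by (simp add: associator_def free_hom_simps free_hom_minus)
  {
    assume "u \<in> homogeneous 0" "v \<in> homogeneous 0" "w \<in> homogeneous 0"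
    then have "(jvar(Y 0 := u, Y 1 := v, Y 2 := w)) x \<in> homogeneous (var_degree x)" for x
      by (auto simp: homogeneous_var)
    from I_Sca_graded_hom[OF I_Sca_generators(1) this] show "associator u v w \<in> I_Sca"
      by (simp add: hom free_hom_simps)
  next
    assume "u \<in> homogeneous 1" "v \<in> homogeneous 0" "w \<in> homogeneous 0"
    then have "(jvar(Z 0 := u, Y 0 := v, Y 1 := w)) x \<in> homogeneous (var_degree x)" for x
      by (auto simp: homogeneous_var)
    from I_Sca_graded_hom[OF I_Sca_generators(2) this] show "associator u v w \<in> I_Sca"
      by (simp add: hom free_hom_simps)
  next
    assume "u \<in> homogeneous 0" "v \<in> homogeneous 1" "w \<in> homogeneous 1"
    then have "(jvar(Y 0 := u, Z 0 := v, Z 1 := w)) x \<in> homogeneous (var_degree x)" for x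
      by (auto simp: homogeneous_var)
    from I_Sca_graded_hom[OF I_Sca_generators(3) this] show "associator u v w \<in> I_Sca"
      by (simp add: hom free_hom_simps)
  next
    assume "t \<in> homogeneous 1" "u \<in> homogeneous 1" "v \<in> homogeneous 1" "w \<in> homogeneous 1"
    then have "(jvar(Z 0 := t, Z 1 := u, Z 2 := v, Z 3 := w)) x \<in> homogeneous (var_degree x)" for x
      by (auto simp: homogeneous_var)
    from I_Sca_graded_hom[OF I_Sca_generators(4) this] show "t * associator u v w \<in> I_Sca"
      by (simp add: hom free_hom_simps)
  }
qed

section \<open>The product induced on the quotient\<close>

instantiation quot_Sca :: (field) "{one, times}"
begin

lift_definition one_quot_Sca :: "'a quot_Sca" is 1 .

lift_definition times_quot_Sca :: "'a quot_Sca \<Rightarrow> 'a quot_Sca \<Rightarrow> 'a quot_Sca" is "(*)"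
proof -
  fix f f' g g' :: "'a free_jordan"
  assume "f - f' \<in> I_Sca" "g - g' \<in> I_Sca"
  \<comment> \<open>Telescoping writes \<open>f * g - f' * g'\<close> as a sum of two products, each
    with a factor in the ideal.\<close>
  then have "(f - f') * g + f' * (g - g') \<in> I_Sca"
    by (intro J.subspace_add[OF subspace_I_Sca] I_Sca_mult)
  then show "f * g - f' * g' \<in> I_Sca"
    by (simp add: free_jordan_minus_left free_jordan_minus_right)
qed

instance ..

end

lemma coset_mult: "coset (f * g) = coset f * coset g"
  by (simp add: coset_def times_quot_Sca.abs_eq)

lemma coset_one: "coset 1 = 1"
  by (simp add: coset_def one_quot_Sca_def)

lemma coset_zero: "coset 0 = 0"
  by (simp add: coset_def zero_quot_Sca_def)

lemma quot_laws:
  fixes a b c :: "'k::field quot_Sca"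
  shows "(a + b) * c = a * c + b * c" "a * (b + c) = a * b + a * c"
    "qscale k a * b = qscale k (a * b)" "a * qscale k b = qscale k (a * b)"
    "a * b = b * a" "1 * a = a" "a * 1 = a" "0 * a = 0" "a * 0 = 0"
proof -
  obtain f g h where [simp]: "a = coset f" "b = coset g" "c = coset h"
    using coset_simps(2) by (metis surj_def)
  show "(a + b) * c = a * c + b * c" "a * (b + c) = a * b + a * c"
    "qscale k a * b = qscale k (a * b)" "a * qscale k b = qscale k (a * b)"
    "a * b = b * a" "1 * a = a" "a * 1 = a" "0 * a = 0" "a * 0 = 0"
    using free_jordan_laws(3)[of f g]
    by (simp_all add: free_jordan_laws(1,2,4) free_jordan_distrib_left free_jordan_scale_right
        free_jordan_unit_right free_jordan_zero
        flip: coset_mult coset_one coset_zero coset_simps(3,4))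
qed

section \<open>Even and odd parts of the quotient\<close>

definition qhom :: "bit \<Rightarrow> 'k::field quot_Sca set" where
  "qhom d = coset ` homogeneous d"

lemma qhom_intros:
  "1 \<in> qhom 0" "coset (y i) \<in> qhom 0" "coset (z i) \<in> qhom 1"
  "a \<in> qhom 0 \<Longrightarrow> b \<in> qhom 0 \<Longrightarrow> a * b \<in> qhom 0"
  "a \<in> qhom 0 \<Longrightarrow> c \<in> qhom 1 \<Longrightarrow> a * c \<in> qhom 1"
  "c \<in> qhom 1 \<Longrightarrow> a \<in> qhom 0 \<Longrightarrow> c * a \<in> qhom 1"
  "c \<in> qhom 1 \<Longrightarrow> d \<in> qhom 1 \<Longrightarrow> c * d \<in> qhom 0"
proof -
  have mult: "a * b \<in> qhom e" if "a \<in> qhom c" "b \<in> qhom d" "c + d = e" for a b c d e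
  proof -
    obtain f g where "a = coset f" "f \<in> homogeneous c" "b = coset g" "g \<in> homogeneous d"
      using \<open>a \<in> qhom c\<close> \<open>b \<in> qhom d\<close> unfolding qhom_def by blast
    then show ?thesis unfolding qhom_def by (metis coset_mult homogeneous_mult image_eqI that(3))
  qed
  show "a \<in> qhom 0 \<Longrightarrow> b \<in> qhom 0 \<Longrightarrow> a * b \<in> qhom 0"
    by (erule mult, assumption) simp
  show "a \<in> qhom 0 \<Longrightarrow> c \<in> qhom 1 \<Longrightarrow> a * c \<in> qhom 1"
    by (erule mult, assumption) simp
  show "c \<in> qhom 1 \<Longrightarrow> a \<in> qhom 0 \<Longrightarrow> c * a \<in> qhom 1"
    by (erule mult, assumption) simp
  show "c \<in> qhom 1 \<Longrightarrow> d \<in> qhom 1 \<Longrightarrow> c * d \<in> qhom 0"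
    by (erule mult, assumption) simp
  show "1 \<in> qhom 0"
    using imageI[OF homogeneous_one, of coset] by (simp only: qhom_def coset_one)
  show "coset (y i) \<in> qhom 0" "coset (z i) \<in> qhom 1"
    unfolding qhom_def by (rule imageI, rule homogeneous_y, rule imageI, rule homogeneous_z)
qed

lemma coset_eq_of_associator:
  "associator u v w \<in> I_Sca \<Longrightarrow> (coset u * coset v) * coset w = coset u * (coset v * coset w)"
  by (simp add: coset_simps(1) associator_def flip: coset_mult)

text \<open>In order: associativity of the even part, the module law for the odd part, and linearity
  of the odd-odd product over the even part, one from each of the first three generators.\<close>

lemma quot_assoc:
  shows "a \<in> qhom 0 \<Longrightarrow> b \<in> qhom 0 \<Longrightarrow> c \<in> qhom 0 \<Longrightarrow> (a * b) * c = a * (b * c)"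
    and "a \<in> qhom 1 \<Longrightarrow> b \<in> qhom 0 \<Longrightarrow> c \<in> qhom 0 \<Longrightarrow> (a * b) * c = a * (b * c)"
    and "a \<in> qhom 0 \<Longrightarrow> b \<in> qhom 1 \<Longrightarrow> c \<in> qhom 1 \<Longrightarrow> (a * b) * c = a * (b * c)"
  unfolding qhom_def
  by (blast intro: coset_eq_of_associator I_Sca_associators(1),
      blast intro: coset_eq_of_associator I_Sca_associators(2),
      blast intro: coset_eq_of_associator I_Sca_associators(3))

lemma quot_module_assoc:
  "a \<in> qhom 0 \<Longrightarrow> b \<in> qhom 0 \<Longrightarrow> c \<in> qhom 1 \<Longrightarrow> (a * b) * c = a * (b * c)"
  using quot_assoc(2)[of c b a] by (simp add: quot_laws(5))

text \<open>Multiply the associator of a, b, d by c. The third law of \<open>quot_assoc\<close> then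
  turns c((ab)d) and c(a(bd)) into products of two even elements.\<close>

lemma quot_odd_swap:
  assumes "a \<in> qhom 1" "b \<in> qhom 1" "c \<in> qhom 1" "d \<in> qhom 1"
  shows "(a * b) * (c * d) = (a * c) * (b * d)"
proof -
  obtain f g h k where co: "a = coset f" "b = coset g" "c = coset h" "d = coset k"
    and hom: "f \<in> homogeneous 1" "g \<in> homogeneous 1" "h \<in> homogeneous 1" "k \<in> homogeneous 1"
    using assms unfolding qhom_def by blast
  have "h * ((f * g) * k) - h * (f * (g * k)) \<in> I_Sca"
    using I_Sca_associators(4)[of h f g k] hom by (simp add: associator_def free_jordan_minus_right)
  then have "c * ((a * b) * d) = c * (a * (b * d))"
    unfolding co by (simp add: coset_simps(1) flip: coset_mult)
  moreover have "c * ((a * b) * d) = (a * b) * (c * d)"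
    using quot_assoc(3)[of "a * b" d c] assms by (simp add: qhom_intros quot_laws(5))
  moreover have "c * (a * (b * d)) = (a * c) * (b * d)"
    using quot_assoc(3)[of "b * d" a c] assms by (simp add: qhom_intros quot_laws(5))
  ultimately show ?thesis by simp
qed

lemma quot_even_swap:
  assumes "a \<in> qhom 0" "b \<in> qhom 0" "c \<in> qhom 0" "d \<in> qhom 0"
  shows "(a * b) * (c * d) = (a * c) * (b * d)"
proof -
  have "(a * b) * (c * d) = a * ((b * c) * d)" using assms by (simp add: quot_assoc(1) qhom_intros)
  also have "\<dots> = a * ((c * b) * d)" by (simp only: quot_laws(5)[of b c])
  finally show ?thesis using assms by (simp add: quot_assoc(1) qhom_intros)
qed

text \<open>Associativity of the even part lets the initial value factor out on the left. This is
  what allows a left-normed product to be cut at any place.\<close>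

lemma quot_foldl:
  assumes "a \<in> qhom 0" "set xs \<subseteq> qhom 0"
  shows "foldl (*) a xs = a * foldl (*) 1 xs \<and> foldl (*) a xs \<in> qhom 0"
  using assms(2)
proof (induction xs rule: rev_induct)
  case Nil show ?case using assms(1) by (simp add: quot_laws(7))
next
  case (snoc x xs)
  have "foldl (*) 1 xs \<in> qhom 0"
    using snoc.prems by (induction xs rule: rev_induct) (auto intro: qhom_intros)
  then show ?case
    using snoc assms(1) by (auto simp: quot_assoc(1) intro: qhom_intros)
qed

lemma coset_left_normed: "coset (left_normed fs) = foldl (*) 1 (map coset fs)"
  by (induction fs rule: rev_induct) (simp_all add: left_normed_def coset_one coset_mult)

lemma left_normed_qhom:
  assumes "coset ` set fs \<subseteq> qhom 0"
  shows "coset (left_normed fs) \<in> qhom 0"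
  using quot_foldl[of 1 "map coset fs"] assms by (simp add: coset_left_normed qhom_intros)

lemma left_normed_append:
  assumes "coset ` set fs \<subseteq> qhom 0" "coset ` set gs \<subseteq> qhom 0"
  shows "coset (left_normed (fs @ gs)) = coset (left_normed fs) * coset (left_normed gs)"
  using quot_foldl[of "coset (left_normed fs)" "map coset gs"] assms left_normed_qhom[of fs]
  by (simp add: coset_left_normed)

section \<open>Normal forms\<close>

definition Y_pow :: "nat \<Rightarrow> nat \<Rightarrow> 'k::field free_jordan" where
  "Y_pow i k = left_normed (replicate k (y i))"

lemma Y_prod_eq: "Y_prod ks = left_normed (map (\<lambda>i. Y_pow i (ks ! i)) [0..<length ks])"
  by (simp add: Y_prod_def Y_pow_def)

lemma Y_prod_map_Suc:
  "Y_prod (map e [0..<Suc n]) = Y_prod (map e [0..<n]) * Y_pow n (e n)"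
proof -
  have *: "Y_prod (map e [0..<m]) = left_normed (map (\<lambda>i. Y_pow i (e i)) [0..<m])" for m
    unfolding Y_prod_eq by (rule arg_cong[where f = left_normed]) simp
  show ?thesis unfolding * by (simp add: left_normed_def)
qed

text \<open>Extension by zero makes exponent lists of different lengths comparable.\<close>

definition exponent :: "nat list \<Rightarrow> nat \<Rightarrow> nat" where
  "exponent ks i = (if i < length ks then ks ! i else 0)"

text \<open>Missing variables enter with exponent 0, that is, as a factor 1. The equation holds in
  $J(X)$ itself, so it also identifies equal members of \<open>S_Sca\<close>.\<close>

lemma Y_prod_pad:
  assumes "length ks \<le> n"
  shows "Y_prod ks = Y_prod (map (exponent ks) [0..<n])"
  using assms
proof (induction n rule: dec_induct)
  case base
  have "map (exponent ks) [0..<length ks] = ks"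
    by (rule nth_equalityI) (auto simp: exponent_def)
  then show ?case by (simp only:)
next
  case (step n)
  then have "exponent ks n = 0" by (simp add: exponent_def)
  with step.IH show ?case
    by (simp only: Y_prod_map_Suc) (simp add: Y_pow_def left_normed_def free_jordan_unit_right)
qed

lemma Y_pow_qhom: "coset (Y_pow i k) \<in> qhom 0"
  unfolding Y_pow_def by (rule left_normed_qhom) (auto intro: qhom_intros)

lemma Y_pow_add: "coset (Y_pow i (k + l)) = coset (Y_pow i k) * coset (Y_pow i l)"
  unfolding Y_pow_def replicate_add by (rule left_normed_append) (auto intro: qhom_intros)

lemma Y_prod_qhom: "coset (Y_prod ks) \<in> qhom 0"
  unfolding Y_prod_eq by (rule left_normed_qhom) (auto intro: Y_pow_qhom)

text \<open>Pad both lists to a common length; exponents then add, since even factors can be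
  regrouped.\<close>

lemma Y_prod_mult:
  "\<exists>ms. coset (Y_prod ks) * coset (Y_prod ls) = coset (Y_prod ms :: 'k::field free_jordan)"
proof -
  have add: "coset (Y_prod (map d [0..<n])) * coset (Y_prod (map e [0..<n]))
      = coset (Y_prod (map (\<lambda>i. d i + e i) [0..<n]) :: 'k free_jordan)" for d e n
  proof (induction n)
    case 0 show ?case by (simp add: Y_prod_def left_normed_def coset_one quot_laws(6,7))
  next
    case (Suc n)
    show ?case
      by (simp only: Y_prod_map_Suc coset_mult Y_pow_add Suc
          quot_even_swap[OF Y_prod_qhom Y_pow_qhom Y_prod_qhom Y_pow_qhom])
  qed
  define n where "n = max (length ks) (length ls)"
  have "Y_prod ks = (Y_prod (map (exponent ks) [0..<n]) :: 'k free_jordan)"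
    "Y_prod ls = (Y_prod (map (exponent ls) [0..<n]) :: 'k free_jordan)"
    by (simp_all add: Y_prod_pad n_def)
  then have "coset (Y_prod ks) * coset (Y_prod ls) =
      coset (Y_prod (map (\<lambda>i. exponent ks i + exponent ls i) [0..<n]) :: 'k free_jordan)"
    by (simp only: add)
  then show ?thesis by blast
qed

section \<open>Words in odd variables\<close>

fun pairs :: "'a list \<Rightarrow> ('a \<times> 'a) list" where
  "pairs (i # j # xs) = (i, j) # pairs xs"
| "pairs _ = []"

definition flat :: "('a \<times> 'a) list \<Rightarrow> 'a list" where
  "flat ps = concat (map (\<lambda>(i, j). [i, j]) ps)"

lemma flat_simps: "flat [] = []" "flat ((i, j) # ps) = i # j # flat ps"
  by (simp_all add: flat_def)

lemma pairs_flat: "pairs (flat ps) = ps"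
  by (induction ps) (auto simp: flat_simps)

lemma flat_pairs: "even (length xs) \<Longrightarrow> flat (pairs xs) = xs"
  by (induction xs rule: pairs.induct) (auto simp: flat_simps)

lemma even_length_flat: "even (length (flat ps))"
  by (induction ps) (auto simp: flat_simps)

lemma pairs_append: "even (length xs) \<Longrightarrow> pairs (xs @ ys) = pairs xs @ pairs ys"
  by (induction xs rule: pairs.induct) auto

text \<open>Letters instead of pairs make the symmetry in all positions expressible.
  \<open>pairs\<close> discards an unpaired last letter, so this is the intended product only for
  words of even length.\<close>

definition zword :: "nat list \<Rightarrow> 'k::field quot_Sca" where
  "zword xs = coset (Z_prod (pairs xs))"

lemma Z_prod_append:
  "coset (Z_prod (ps @ qs)) = coset (Z_prod ps) * coset (Z_prod qs)"
  unfolding Z_prod_def map_append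
  by (rule left_normed_append) (auto simp: coset_mult intro!: qhom_intros)

lemma Z_prod_qhom: "coset (Z_prod ps) \<in> qhom 0"
  unfolding Z_prod_def by (rule left_normed_qhom) (auto simp: coset_mult intro!: qhom_intros)

lemma zword_qhom: "zword xs \<in> qhom 0"
  by (simp add: zword_def Z_prod_qhom)

lemma zword_append: "even (length xs) \<Longrightarrow> zword (xs @ ys) = zword xs * zword ys"
  by (simp add: zword_def pairs_append Z_prod_append)

lemma zword_Nil: "zword [] = 1"
  by (simp add: zword_def Z_prod_def left_normed_def coset_one)

lemma zword_pair: "zword [i, j] = coset (z i) * coset (z j)"
  by (simp add: zword_def Z_prod_def left_normed_def coset_mult coset_one quot_laws(6,7))

lemma zword_Cons: "zword (i # j # xs) = (coset (z i) * coset (z j)) * zword xs"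
  using zword_append[of "[i, j]" xs] by (simp add: zword_pair)

text \<open>Peeling leading pairs off xs leaves the transposition either inside one pair or across
  two neighbouring pairs.\<close>

lemma zword_swap:
  "even (length xs + length ys) \<Longrightarrow>
    zword (xs @ i # j # ys) = (zword (xs @ j # i # ys) :: 'k::field quot_Sca)"
proof (induction xs rule: pairs.induct)
  case (1 k l xs)
  then show ?case by (simp add: zword_Cons)
next
  \<comment> \<open>Here i and j form a pair, and commutativity suffices.\<close>
  case "2_1"
  then show ?case by (simp add: zword_Cons quot_laws(5)[of "coset (z i)"])
next
  case ("2_2" k)
  \<comment> \<open>The transposed letters straddle the pairs (k, i) and (j, l); parity guarantees
    the letter l.\<close>
  then obtain l ys' where ys: "ys = l # ys'" by (cases ys) auto
  have split: "zword (a # b # c # d # ys') =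
      ((coset (z a) * coset (z b)) * (coset (z c) * coset (z d))) * (zword ys' :: 'k quot_Sca)" for a b c d
    by (simp add: zword_Cons quot_assoc(1) qhom_intros zword_qhom)
  show ?case
    using quot_odd_swap[OF qhom_intros(3) qhom_intros(3) qhom_intros(3) qhom_intros(3), of k i j l,
        where 'a='k]
    by (simp only: ys append.simps split)
qed

text \<open>Insertion is a chain of adjacent transpositions. The arbitrary prefix xs lets the
  induction step pass a letter to it, shifting the pairing.\<close>

lemma zword_insort:
  "even (length xs + Suc (length ys)) \<Longrightarrow>
    zword (xs @ insort i ys) = (zword (xs @ i # ys) :: 'k::field quot_Sca)"
proof (induction ys arbitrary: xs)
  case (Cons j ys)
  have "zword ((xs @ [j]) @ insort i ys) = (zword ((xs @ [j]) @ i # ys) :: 'k quot_Sca)"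
    using Cons.prems by (intro Cons.IH) simp
  moreover have "zword (xs @ i # j # ys) = (zword (xs @ j # i # ys) :: 'k quot_Sca)"
    using Cons.prems by (intro zword_swap) simp
  ultimately show ?case by simp
qed simp

lemma zword_sort:
  "even (length xs + length ys) \<Longrightarrow> zword (xs @ sort ys) = (zword (xs @ ys) :: 'k::field quot_Sca)"
proof (induction ys arbitrary: xs)
  case (Cons j ys)
  have "zword ((xs @ [j]) @ sort ys) = (zword ((xs @ [j]) @ ys) :: 'k quot_Sca)"
    using Cons.prems by (intro Cons.IH) simp
  moreover have "zword (xs @ insort j (sort ys)) = (zword (xs @ j # sort ys) :: 'k quot_Sca)"
    using Cons.prems by (intro zword_insort) simp
  ultimately show ?case by simp
qed simp

lemma zword_sorted:
  assumes "even (length xs)"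
  shows "\<exists>ps. index_sorted ps \<and> zword xs = (coset (Z_prod ps) :: 'k::field quot_Sca)"
proof (intro exI conjI)
  show "index_sorted (pairs (sort xs))"
    using flat_pairs[of "sort xs"] assms by (simp add: index_sorted_def flat_def)
  show "zword xs = (coset (Z_prod (pairs (sort xs))) :: 'k quot_Sca)"
    using zword_sort[of "[]" xs, where 'k='k] assms by (simp add: zword_def)
qed

lemma Z_prod_zword: "coset (Z_prod ps) = zword (flat ps)"
  by (simp add: zword_def pairs_flat)

section \<open>Closure of the normal forms under multiplication, and spanning\<close>

definition S_even :: "'k::field free_jordan set" where
  "S_even = {Y_prod ks * Z_prod ps | ks ps. index_sorted ps}"

definition S_odd :: "'k::field free_jordan set" where
  "S_odd = {Y_prod ks * (z i * Z_prod ps) | ks i ps. index_sorted ps}"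

lemma S_Sca_eq: "S_Sca = S_even \<union> S_odd"
  by (simp add: S_Sca_def S_even_def S_odd_def)

lemma coset_S_even:
  assumes "a \<in> coset ` S_even"
  obtains ks xs where "a = coset (Y_prod ks) * zword xs" "even (length xs)"
  using assms unfolding S_even_def
  by (auto simp: coset_mult Z_prod_zword even_length_flat)

text \<open>Writing the odd letter last collects all even factors into one coefficient acting on
  it.\<close>

lemma coset_S_odd:
  assumes "a \<in> coset ` S_odd"
  obtains ks i xs where "a = (coset (Y_prod ks) * zword xs) * coset (z i)" "even (length xs)"
proof -
  obtain ks i ps where a: "a = coset (Y_prod ks) * (coset (z i) * zword (flat ps))"
    using assms unfolding S_odd_def by (auto simp: coset_mult Z_prod_zword)
  then have "a = (coset (Y_prod ks) * zword (flat ps)) * coset (z i)"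
    by (simp add: quot_module_assoc Y_prod_qhom zword_qhom qhom_intros quot_laws(5)[of "coset (z i)"])
  then show thesis using that even_length_flat by blast
qed

lemma S_even_coset:
  assumes "even (length xs)"
  shows "coset (Y_prod ks) * zword xs \<in> coset ` (S_even :: 'k::field free_jordan set)"
proof -
  obtain ps where ps: "index_sorted ps" "zword xs = (coset (Z_prod ps) :: 'k quot_Sca)"
    using zword_sorted[OF assms] by blast
  then have "coset (Y_prod ks) * zword xs = coset (Y_prod ks * Z_prod ps :: 'k free_jordan)"
    by (simp add: coset_mult)
  then show ?thesis using ps(1) unfolding S_even_def by blast
qed

lemma S_odd_coset:
  assumes "even (length xs)"
  shows "(coset (Y_prod ks) * zword xs) * coset (z i) \<in> coset ` (S_odd :: 'k::field free_jordan set)"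
proof -
  obtain ps where ps: "index_sorted ps" "zword xs = (coset (Z_prod ps) :: 'k quot_Sca)"
    using zword_sorted[OF assms] by blast
  have "(coset (Y_prod ks) * zword xs) * coset (z i) =
      coset (Y_prod ks * (z i * Z_prod ps) :: 'k free_jordan)"
    using ps(2) by (simp add: quot_module_assoc Y_prod_qhom Z_prod_qhom qhom_intros coset_mult
        quot_laws(5)[of "coset (z i)"])
  then show ?thesis using ps(1) unfolding S_odd_def by blast
qed

lemma even_monomial_mult:
  assumes "even (length xs)"
  shows "\<exists>ms. (coset (Y_prod ks) * zword xs) * (coset (Y_prod ls) * zword ys)
     = coset (Y_prod ms) * (zword (xs @ ys) :: 'k::field quot_Sca)"
  unfolding zword_append[OF assms] quot_even_swap[OF Y_prod_qhom zword_qhom Y_prod_qhom zword_qhom]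
  using Y_prod_mult[of ks ls, where 'k='k] by metis

text \<open>A product of two normal forms is a single normal form again, with no linear combination:
  exponents add, odd words are concatenated and sorted.\<close>

lemma coset_S_mult:
  fixes a b :: "'k::field quot_Sca"
  shows "a \<in> coset ` S_even \<Longrightarrow> b \<in> coset ` S_even \<Longrightarrow> a * b \<in> coset ` S_even"
    and "a \<in> coset ` S_even \<Longrightarrow> b \<in> coset ` S_odd \<Longrightarrow> a * b \<in> coset ` S_odd"
    and "a \<in> coset ` S_odd \<Longrightarrow> b \<in> coset ` S_odd \<Longrightarrow> a * b \<in> coset ` S_even"
proof -
  show "a * b \<in> coset ` S_even" if a: "a \<in> coset ` S_even" and b: "b \<in> coset ` S_even"
  proof -
    obtain ks xs where a_eq: "a = coset (Y_prod ks) * zword xs" "even (length xs)"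
      using a by (rule coset_S_even)
    obtain ls ys where b_eq: "b = coset (Y_prod ls) * zword ys" "even (length ys)"
      using b by (rule coset_S_even)
    obtain ms where "a * b = coset (Y_prod ms) * zword (xs @ ys)"
      using even_monomial_mult[OF a_eq(2), where 'k='k] unfolding a_eq(1) b_eq(1) by blast
    then show ?thesis using a_eq(2) b_eq(2) by (simp only: S_even_coset length_append even_add)
  qed
  show "a * b \<in> coset ` S_odd" if a: "a \<in> coset ` S_even" and b: "b \<in> coset ` S_odd"
  proof -
    obtain ks xs where a_eq: "a = coset (Y_prod ks) * zword xs" "even (length xs)"
      using a by (rule coset_S_even)
    obtain ls i ys where b_eq: "b = (coset (Y_prod ls) * zword ys) * coset (z i)" "even (length ys)"
      using b by (rule coset_S_odd)
    have "a * b = (a * (coset (Y_prod ls) * zword ys)) * coset (z i)"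
      unfolding a_eq(1) b_eq(1)
      by (intro quot_module_assoc[symmetric] qhom_intros Y_prod_qhom zword_qhom)
    moreover obtain ms where "a * (coset (Y_prod ls) * zword ys) = coset (Y_prod ms) * zword (xs @ ys)"
      using even_monomial_mult[OF a_eq(2), where 'k='k] unfolding a_eq(1) by blast
    ultimately show ?thesis using a_eq(2) b_eq(2) by (simp only: S_odd_coset length_append even_add)
  qed
  show "a * b \<in> coset ` S_even" if a: "a \<in> coset ` S_odd" and b: "b \<in> coset ` S_odd"
  proof -
    obtain ks i xs where a_eq: "a = (coset (Y_prod ks) * zword xs) * coset (z i)" "even (length xs)"
      using a by (rule coset_S_odd)
    obtain ls j ys where b_eq: "b = (coset (Y_prod ls) * zword ys) * coset (z j)" "even (length ys)"
      using b by (rule coset_S_odd)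
    define p q where "p = (coset (Y_prod ks) * zword xs :: 'k quot_Sca)"
      and "q = (coset (Y_prod ls) * zword ys :: 'k quot_Sca)"
    have pq: "p \<in> qhom 0" "q \<in> qhom 0" by (simp_all add: p_def q_def qhom_intros(4) Y_prod_qhom zword_qhom)
    \<comment> \<open>Both even coefficients are pulled out of the product of odd elements; what
      remains is one new pair, appended to the word.\<close>
    have "a * b = p * (coset (z i) * (q * coset (z j)))"
      unfolding a_eq(1) b_eq(1) p_def[symmetric] q_def[symmetric]
      by (intro quot_assoc(3) pq qhom_intros)
    also have "coset (z i) * (q * coset (z j)) = (q * coset (z j)) * coset (z i)"
      by (rule quot_laws(5))
    also have "\<dots> = q * (coset (z j) * coset (z i))"
      by (intro quot_assoc(3) pq qhom_intros)
    also have "\<dots> = q * zword [j, i]"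
      by (simp only: zword_pair)
    also have "p * (q * zword [j, i]) = (p * q) * zword [j, i]"
      by (intro quot_assoc(1)[symmetric] pq zword_qhom)
    also obtain ms where "p * q = coset (Y_prod ms) * zword (xs @ ys)"
      using even_monomial_mult[OF a_eq(2), where 'k='k] unfolding p_def q_def by blast
    also have "(coset (Y_prod ms) * zword (xs @ ys)) * zword [j, i] =
        coset (Y_prod ms) * (zword (xs @ ys) * zword [j, i] :: 'k quot_Sca)"
      by (intro quot_assoc(1) Y_prod_qhom zword_qhom)
    also have "zword (xs @ ys) * zword [j, i] = (zword ((xs @ ys) @ [j, i]) :: 'k quot_Sca)"
      using a_eq(2) b_eq(2) by (intro zword_append[symmetric]) simp
    finally show ?thesis using a_eq(2) b_eq(2) S_even_coset[of "(xs @ ys) @ [j, i]" ms] by simp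
  qed
qed

lemma span_mult:
  assumes "\<And>a b. a \<in> A \<Longrightarrow> b \<in> B \<Longrightarrow> a * b \<in> Q.span C"
    and a: "a \<in> Q.span A" and b: "b \<in> Q.span B"
  shows "a * b \<in> Q.span C"
proof -
  have "a * b \<in> Q.span C" if "a \<in> A" for a
    using b by (induction rule: Q.span_induct_alt)
      (auto simp: quot_laws(1-4,8,9) that assms(1) Q.span_zero intro!: Q.span_add Q.span_scale)
  with a show ?thesis
    by (induction rule: Q.span_induct_alt)
      (auto simp: quot_laws(1-4,8,9) Q.span_zero intro!: Q.span_add Q.span_scale)
qed

text \<open>The span is closed under multiplication and contains the unit and the variables, so
  induction on the free algebra shows that it is everything.\<close>

lemma coset_S_span: "Q.span (coset ` S_Sca) = (UNIV :: 'k::field quot_Sca set)"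
proof -
  let ?B = "coset ` (S_Sca :: 'k free_jordan set)"
  have E: "coset ` S_even \<subseteq> ?B" and O: "coset ` S_odd \<subseteq> ?B" by (auto simp: S_Sca_eq)
  have "a * b \<in> ?B" if "a \<in> ?B" "b \<in> ?B" for a b
  proof -
    have B: "?B = coset ` S_even \<union> coset ` S_odd" by (simp only: S_Sca_eq image_Un)
    from that consider "a \<in> coset ` S_even" "b \<in> coset ` S_even" | "a \<in> coset ` S_even" "b \<in> coset ` S_odd"
      | "b \<in> coset ` S_even" "a \<in> coset ` S_odd" | "a \<in> coset ` S_odd" "b \<in> coset ` S_odd"
      unfolding B by blast
    then show ?thesis
    proof cases
      case 1 then show ?thesis using coset_S_mult(1) B by blast
    next
      case 2 then show ?thesis using coset_S_mult(2) B by blast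
    next
      case 3 then show ?thesis using coset_S_mult(2)[of b a] B unfolding quot_laws(5)[of a b] by blast
    next
      case 4 then show ?thesis using coset_S_mult(3) B by blast
    qed
  qed
  then have mult: "a * b \<in> Q.span ?B" if "a \<in> Q.span ?B" "b \<in> Q.span ?B" for a b
    using span_mult[OF _ that, of ?B] Q.span_base by blast
  have one: "1 \<in> ?B"
    using S_even_coset[of "[]" "[]"] E
    by (auto simp: Y_prod_def left_normed_def coset_one zword_Nil quot_laws(6,7))
  have "coset (y i) \<in> ?B" for i
  proof -
    \<comment> \<open>The variable with index i has exponent 1 at position i; the i preceding
      exponents are zero and contribute only the unit, \<open>exponent []\<close> being the zero
      function.\<close>
    have "Y_prod (map (exponent []) [0..<i]) = (1 :: 'k free_jordan)"
      using Y_prod_pad[of "[]" i] by (simp add: Y_prod_def left_normed_def)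
    moreover have "map (exponent []) [0..<i] = map (\<lambda>j. of_bool (j = i)) [0..<i]"
      by (simp add: exponent_def)
    ultimately have "Y_prod (map (\<lambda>j. of_bool (j = i)) [0..<Suc i]) = (y i :: 'k free_jordan)"
      by (simp only: Y_prod_map_Suc) (simp add: Y_pow_def left_normed_def free_jordan_laws(4))
    then show ?thesis using S_even_coset[of "[]" "map (\<lambda>j. of_bool (j = i)) [0..<Suc i]", where 'k='k] E
      by (auto simp: zword_Nil quot_laws(6,7) simp del: upt_Suc)
  qed
  moreover have "coset (z i) \<in> ?B" for i
    using S_odd_coset[of "[]" "[]" i] O
    by (auto simp: Y_prod_def left_normed_def coset_one zword_Nil quot_laws(6,7))
  ultimately have var: "coset (jvar x) \<in> ?B" for x by (cases x) auto
  have "coset f \<in> Q.span ?B" for f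
    by (induction f rule: free_jordan_induct)
      (simp_all add: var one Q.span_base Q.span_zero Q.span_add Q.span_scale mult coset_zero
        coset_one coset_mult coset_simps(3,4))
  then have "range coset \<subseteq> Q.span ?B" by blast
  then show ?thesis by (simp only: coset_simps(2) top.extremum_unique)
qed

section \<open>Evaluation in $UJ_2$\<close>

text \<open>Substitution is a homomorphism once evaluation is independent of the representing term.
  The characteristic enters here, through the unit law for \<open>mat 1\<close>.\<close>

lemma subst_simps:
  assumes "(2::'k::field) \<noteq> 0"
  shows "subst \<rho> (jvar x) = (\<rho> x :: 'k mat2)"
    "subst \<rho> 0 = (0 :: 'k mat2)"
    "subst \<rho> 1 = (mat 1 :: 'k mat2)"
    "subst \<rho> (f + g) = subst \<rho> f + (subst \<rho> g :: 'k mat2)"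
    "subst \<rho> (jscale a f) = mscale a (subst \<rho> f :: 'k mat2)"
    "subst \<rho> (f * g) = subst \<rho> f \<circ>\<^sub>J (subst \<rho> g :: 'k mat2)"
proof -
  have "\<exists>s. h = abs_free_jordan s" for h :: "'k free_jordan"
    by (rule free_jordan.abs_induct) blast
  then obtain s t where "f = abs_free_jordan s" "g = abs_free_jordan t" by metis
  then show "subst \<rho> (jvar x) = \<rho> x" "subst \<rho> 0 = 0" "subst \<rho> 1 = mat 1"
    "subst \<rho> (f + g) = subst \<rho> f + subst \<rho> g"
    "subst \<rho> (jscale a f) = mscale a (subst \<rho> f)" "subst \<rho> (f * g) = subst \<rho> f \<circ>\<^sub>J subst \<rho> g"
    by (simp_all add: subst_eq[OF assms] jvar.abs_eq zero_free_jordan_def one_free_jordan_def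
        plus_free_jordan.abs_eq jscale.abs_eq times_free_jordan.abs_eq)
qed

section \<open>The identities form a graded T-ideal containing the generators\<close>

definition graded_assignment :: "(var \<Rightarrow> 'k::field mat2) \<Rightarrow> bool" where
  "graded_assignment \<rho> \<longleftrightarrow> (\<forall>x. \<rho> x \<in> UJ2_Sca (var_degree x))"

lemma T_Sca_iff: "f \<in> T_Sca \<longleftrightarrow> (\<forall>\<rho>. graded_assignment \<rho> \<longrightarrow> subst \<rho> f = 0)"
proof -
  have "graded_assignment \<rho> \<longleftrightarrow> (\<forall>i. \<rho> (Y i) \<in> UJ2_Sca 0) \<and> (\<forall>i. \<rho> (Z i) \<in> UJ2_Sca 1)"
    for \<rho> :: "var \<Rightarrow> 'a mat2"
    unfolding graded_assignment_def by (metis var.exhaust var_degree.simps)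
  then show ?thesis by (simp add: T_Sca_def)
qed

lemma subspace_UJ2_Sca: "M.subspace (UJ2_Sca d)"
  by (simp add: UJ2_Sca_def)

lemma subst_homogeneous:
  assumes "(2::'k::field) \<noteq> 0" "graded_assignment \<rho>" "f \<in> homogeneous d"
  shows "subst \<rho> f \<in> (UJ2_Sca d :: 'k mat2 set)"
proof -
  have mono: "subst \<rho> m \<in> UJ2_Sca d" if "monomial m d" for m d
    using that
  proof induction
    case one show ?case by (simp add: subst_simps assms(1) mem_UJ2_Sca mat_def)
  next
    case (var x) then show ?case using assms(2) by (simp add: subst_simps assms(1) graded_assignment_def)
  next
    case mult then show ?case by (simp only: subst_simps(6)[OF assms(1)] UJ2_Sca_grading(3)[OF assms(1)])
  qed
  from assms(3) show ?thesis unfolding homogeneous_def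
    by (induction rule: J.span_induct_alt)
      (auto simp: subst_simps assms(1) mono intro!: M.subspace_0 M.subspace_add M.subspace_scale
        subspace_UJ2_Sca)
qed

lemma mscale_simps: "mscale c 0 = 0" "A \<circ>\<^sub>J 0 = 0" "0 \<circ>\<^sub>J A = 0"
  by (simp_all add: vec_eq_iff mscale_def jprod_nth)

lemma T_ideal_T_Sca:
  assumes "(2::'k::field) \<noteq> 0"
  shows "T_ideal (T_Sca :: 'k free_jordan set)"
  unfolding T_ideal_def
proof (intro conjI allI ballI impI)
  show "J.subspace (T_Sca :: 'k free_jordan set)"
    by (simp add: J.subspace_def T_Sca_iff subst_simps assms)
next
  fix f g :: "'k free_jordan" assume "f \<in> T_Sca"
  then show "f * g \<in> T_Sca" "g * f \<in> T_Sca"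
    by (simp_all add: T_Sca_iff subst_simps assms mscale_simps)
next
  fix \<phi> :: "'k free_jordan \<Rightarrow> 'k free_jordan" assume \<phi>: "graded_endomorphism \<phi>"
  then interpret \<phi>: Vector_Spaces.linear jscale jscale \<phi> by (simp add: graded_endomorphism_def)
  have "subst \<rho> (\<phi> f) = 0" if f: "f \<in> T_Sca" and \<rho>: "graded_assignment \<rho>" for f \<rho>
  proof -
    \<comment> \<open>Evaluating an image under \<phi> at \<rho> is evaluating the original at
      \<sigma>, which is graded because \<phi> preserves degrees.\<close>
    define \<sigma> where "\<sigma> = (\<lambda>x. subst \<rho> (\<phi> (jvar x)))"
    have "subst \<rho> (\<phi> g) = subst \<sigma> g" for g
      using \<phi> by (induction g rule: free_jordan_induct)
        (simp_all add: subst_simps assms \<sigma>_def \<phi>.zero \<phi>.add \<phi>.scale graded_endomorphism_def)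
    moreover have "\<phi> (jvar x) \<in> homogeneous (var_degree x)" for x
      using \<phi> homogeneous_var unfolding graded_endomorphism_def by blast
    then have "graded_assignment \<sigma>"
      using subst_homogeneous[OF assms \<rho>] by (simp add: graded_assignment_def \<sigma>_def)
    ultimately show ?thesis using f by (simp add: T_Sca_iff)
  qed
  then show "\<phi> ` T_Sca \<subseteq> T_Sca" by (auto simp: T_Sca_iff)
qed

lemma subst_minus:
  assumes "(2::'k::field) \<noteq> 0"
  shows "subst \<rho> (f - g) = subst \<rho> f - (subst \<rho> g :: 'k mat2)"
  using subst_simps(4)[OF assms, of \<rho> "f - g" g] by (simp add: algebra_simps)

lemma I_Sca_subset_T_Sca:
  assumes "(2::'k::field) \<noteq> 0"
  shows "I_Sca \<subseteq> (T_Sca :: 'k free_jordan set)"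
  unfolding I_Sca_def
proof (rule hull_minimal)
  show "T_ideal (T_Sca :: 'k free_jordan set)" by (rule T_ideal_T_Sca[OF assms])
  have Y: "\<rho> (Y i) \<in> UJ2_Sca 0" if "graded_assignment \<rho>" for i and \<rho> :: "var \<Rightarrow> 'k mat2"
    using that unfolding graded_assignment_def by (metis var_degree.simps(1))
  have Z: "\<rho> (Z i) \<in> UJ2_Sca 1" if "graded_assignment \<rho>" for i and \<rho> :: "var \<Rightarrow> 'k mat2"
    using that unfolding graded_assignment_def by (metis var_degree.simps(2))
  \<comment> \<open>The check is a polynomial identity in the matrix entries and h, so 1/2 is kept
    as an opaque constant.\<close>
  define h where "h = 1 / (2::'k)"
  have nth: "(A \<circ>\<^sub>J B) $ i $ j = h * (A$i$1 * B$1$j + A$i$2 * B$2$j + (B$i$1 * A$1$j + B$i$2 * A$2$j))"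
    for A B :: "'k mat2" and i j by (simp add: jprod_nth h_def)
  note eval = T_Sca_iff associator_def subst_minus subst_simps assms vec_eq_iff forall_2 nth
  have "associator (y 0) (y 1) (y 2) \<in> (T_Sca :: 'k free_jordan set)"
    using Y by (auto simp: eval mem_UJ2_Sca algebra_simps)
  moreover have "associator (z 0) (y 0) (y 1) \<in> (T_Sca :: 'k free_jordan set)"
    using Y Z by (auto simp: eval mem_UJ2_Sca algebra_simps)
  moreover have "associator (y 0) (z 0) (z 1) \<in> (T_Sca :: 'k free_jordan set)"
    using Y Z by (auto simp: eval mem_UJ2_Sca algebra_simps)
  moreover have "z 0 * associator (z 1) (z 2) (z 3) \<in> (T_Sca :: 'k free_jordan set)"
    using Y Z by (auto simp: eval mem_UJ2_Sca algebra_simps)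
  ultimately show "{associator (y 0) (y 1) (y 2), associator (z 0) (y 0) (y 1),
      associator (y 0) (z 0) (z 1), z 0 * associator (z 1) (z 2) (z 3)} \<subseteq> (T_Sca :: 'k free_jordan set)"
    by simp
qed

section \<open>Independence of monomials\<close>

text \<open>Dedekind's independence of characters: comparing the relation at \<open>mul v w\<close>
  with \<open>ch j w\<close> times the relation at v eliminates j and leaves a shorter
  relation.\<close>

lemma characters_independent:
  fixes ch :: "'i \<Rightarrow> 'm \<Rightarrow> 'k::field"
  assumes "finite F"
    and "\<And>i v w. i \<in> F \<Longrightarrow> ch i (mul v w) = ch i v * ch i w"
    and "\<And>i. i \<in> F \<Longrightarrow> ch i e = 1"
    and "inj_on ch F"
    and "\<And>v. (\<Sum>i\<in>F. c i * ch i v) = 0"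
  shows "\<forall>i\<in>F. c i = 0"
  using assms
proof (induction F arbitrary: c rule: finite_induct)
  case (insert j F)
  have c: "c i = 0" if i: "i \<in> F" for i
  proof -
    have "ch i \<noteq> ch j" using insert.prems(3) insert.hyps i by (auto simp: inj_on_def)
    then obtain w where w: "ch i w \<noteq> ch j w" by blast
    have "(\<Sum>i\<in>F. (c i * (ch i w - ch j w)) * ch i v) = 0" for v
    proof -
      have "(\<Sum>i\<in>insert j F. c i * ch i (mul v w)) - ch j w * (\<Sum>i\<in>insert j F. c i * ch i v) = 0"
        by (simp only: insert.prems(4)) simp
      also have "(\<Sum>i\<in>insert j F. c i * ch i (mul v w)) = (\<Sum>i\<in>insert j F. c i * (ch i v * ch i w))"
        by (intro sum.cong) (simp_all only: insert.prems(1))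
      finally show ?thesis
        using insert.hyps by (simp add: sum_distrib_left sum_subtractf algebra_simps)
    qed
    then have "\<forall>i\<in>F. c i * (ch i w - ch j w) = 0"
      by (intro insert.IH) (use insert.prems in \<open>auto simp: inj_on_def\<close>)
    then show ?thesis using w i by auto
  qed
  \<comment> \<open>The other coefficients are gone, so evaluating at the identity e isolates the
    last one.\<close>
  then have "c j * ch j e = 0" using insert.prems(4)[of e] insert.hyps by simp
  then show ?case using c insert.prems(2)[of j] by simp
qed simp

text \<open>Otherwise X^m - X^n would be a nonzero polynomial vanishing on the whole infinite
  field.\<close>

lemma power_fun_inj:
  assumes "infinite (UNIV :: 'k::field set)" "\<And>s::'k. s ^ m = s ^ n"
  shows "m = n"
proof (rule ccontr)
  assume "m \<noteq> n"
  then have "monom 1 m - monom 1 n \<noteq> (0 :: 'k poly)"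
    by (metis coeff_monom eq_iff_diff_eq_0 one_neq_zero)
  then have "finite {s. poly (monom 1 m - monom 1 n) s = (0::'k)}" by (rule poly_roots_finite)
  then show False using assms by (simp add: poly_monom)
qed

text \<open>Putting s at one coordinate and 1 at all others turns the monomial into a power of s,
  whose exponent is the multiplicity of that coordinate.\<close>

lemma monomial_functions_inj:
  assumes "infinite (UNIV :: 'k::field set)"
    and "\<And>v :: 'a \<Rightarrow> 'k. prod_list (map v xs) = prod_list (map v ws)"
  shows "mset xs = mset ws"
proof (rule multiset_eqI)
  fix a
  have "prod_list (map (\<lambda>u. if u = a then s else 1) xs) = s ^ count (mset xs) a" for s :: 'k and xs :: "'a list"
    by (induction xs) auto
  then show "count (mset xs) a = count (mset ws) a"
    using assms(2)[of "\<lambda>u. if u = a then s else 1" for s] power_fun_inj[OF assms(1)] by metis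
qed

text \<open>The constructors stand for $t_i$, $\alpha_i$ and $\beta_i$.\<close>

datatype coord = Ycoord nat | Zdiag nat | Zoff nat

fun generic_assignment :: "(coord \<Rightarrow> 'k::field) \<Rightarrow> var \<Rightarrow> 'k mat2" where
  "generic_assignment v (Y i) = mat (v (Ycoord i))"
| "generic_assignment v (Z i) = (\<chi> k l. if k = l then (if k = 1 then v (Zdiag i) else - v (Zdiag i))
     else if k = 1 then v (Zoff i) else 0)"

lemma graded_generic_assignment: "graded_assignment (generic_assignment v)"
proof -
  have "generic_assignment v x \<in> UJ2_Sca (var_degree x)" for x
    by (cases x) (simp_all add: mem_UJ2_Sca mat_def)
  then show ?thesis by (simp add: graded_assignment_def)
qed

text \<open>
  The half trace kills the odd component and the corner entry kills the even one, so this single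
  functional separates both kinds of basis elements.
\<close>

definition generic_value :: "(coord \<Rightarrow> 'k) \<Rightarrow> 'k::field free_jordan \<Rightarrow> 'k" where
  "generic_value v f =
    (let A = subst (generic_assignment v) f in (A $ 1 $ 1 + A $ 2 $ 2) / 2 + A $ 1 $ 2)"

text \<open>The monomial in t and \<alpha> carried by $Y'Z'$; an element of form (b) has the further
  factor \<open>Zoff i\<close>.\<close>

definition word :: "nat list \<Rightarrow> (nat \<times> nat) list \<Rightarrow> coord list" where
  "word ks ps = concat (map (\<lambda>i. replicate (ks ! i) (Ycoord i)) [0..<length ks]) @ map Zdiag (flat ps)"

section \<open>Values of S at generic matrices\<close>

context
  assumes two: "(2::'k::field) \<noteq> 0"
begin

lemma mat_jprod: "mat c \<circ>\<^sub>J A = mscale c (A :: 'k mat2)"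
  using two by (auto simp: vec_eq_iff forall_2 jprod_nth mscale_def mat_def field_simps)

lemma mscale_mat: "mscale c (mat d) = (mat (c * d) :: 'k mat2)"
  by (simp add: vec_eq_iff mscale_def mat_def)

lemma subst_left_normed:
  assumes "\<And>x. x \<in> set xs \<Longrightarrow> subst \<rho> (f x) = (mat (g x) :: 'k mat2)"
  shows "subst \<rho> (left_normed (map f xs)) = mat (prod_list (map g xs))"
  using assms
proof (induction xs rule: rev_induct)
  case Nil show ?case by (simp add: left_normed_def subst_simps two)
next
  case (snoc x xs)
  then have "subst \<rho> (left_normed (map f xs)) = mat (prod_list (map g xs))" by simp
  with snoc.prems show ?case by (simp add: left_normed_def subst_simps two mat_jprod mscale_mat)
qed

lemma subst_Y_prod:
  "subst (generic_assignment v) (Y_prod ks) =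
   (mat (prod_list (map v (concat (map (\<lambda>i. replicate (ks ! i) (Ycoord i)) [0..<length ks])))) :: 'k mat2)"
proof -
  have "subst (generic_assignment v) (Y_pow i k) = (mat (v (Ycoord i) ^ k) :: 'k mat2)" for i k
    using subst_left_normed[of "[0..<k]" "generic_assignment v" "\<lambda>_. y i" "\<lambda>_. v (Ycoord i)"]
    by (simp add: Y_pow_def map_replicate_const subst_simps two)
  then have "subst (generic_assignment v) (Y_prod ks) =
      (mat (prod_list (map (\<lambda>i. v (Ycoord i) ^ (ks ! i)) [0..<length ks])) :: 'k mat2)"
    unfolding Y_prod_eq by (rule subst_left_normed)
  also have "prod_list (map (\<lambda>i. v (Ycoord i) ^ (ks ! i)) is) =
      prod_list (map v (concat (map (\<lambda>i. replicate (ks ! i) (Ycoord i)) is)))" for "is"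
    by (induction "is") simp_all
  finally show ?thesis .
qed

text \<open>In the Jordan product of two generic odd matrices the corner terms cancel, leaving the
  scalar matrix \<alpha>_i \<alpha>_j.\<close>

lemma subst_Z_prod:
  "subst (generic_assignment v) (Z_prod ps) = (mat (prod_list (map v (map Zdiag (flat ps)))) :: 'k mat2)"
proof -
  have "subst (generic_assignment v) (Z_prod ps) =
      (mat (prod_list (map (\<lambda>(i, j). v (Zdiag i) * v (Zdiag j)) ps)) :: 'k mat2)"
    unfolding Z_prod_def
    using two by (intro subst_left_normed)
      (auto simp: subst_simps two vec_eq_iff forall_2 jprod_nth mat_def field_simps)
  also have "prod_list (map (\<lambda>(i, j). v (Zdiag i) * v (Zdiag j)) ps) =
      prod_list (map v (map Zdiag (flat ps)))"
    by (induction ps) (auto simp: flat_simps mult.assoc)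
  finally show ?thesis .
qed

text \<open>In form (a) all factors are scalar matrices and only the half trace survives. In form
  (b) a scalar multiplies the matrix of z_i, whose trace is 0 and whose corner entry is
  \<beta>_i.\<close>

lemma generic_value_S:
  "generic_value v (Y_prod ks * Z_prod ps) = (prod_list (map v (word ks ps)) :: 'k)"
  "generic_value v (Y_prod ks * (z i * Z_prod ps)) = (prod_list (map v (Zoff i # word ks ps)) :: 'k)"
proof -
  show "generic_value v (Y_prod ks * Z_prod ps) = (prod_list (map v (word ks ps)) :: 'k)"
    using two by (simp add: generic_value_def subst_simps subst_Y_prod subst_Z_prod mat_jprod mscale_mat
        word_def Let_def) (simp add: mat_def)
  show "generic_value v (Y_prod ks * (z i * Z_prod ps)) = (prod_list (map v (Zoff i # word ks ps)) :: 'k)"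
    using two by (simp add: generic_value_def subst_simps subst_Y_prod subst_Z_prod mat_jprod
        jprod_laws(3)[of "generic_assignment v (Z i)"] word_def Let_def del: generic_assignment.simps)
      (simp add: mscale_def)
qed

end

text \<open>Multiplicities of \<open>Zdiag\<close> letters fix the sorted word, those of
  \<open>Ycoord\<close> letters the exponents. The list ks is fixed only up to trailing zeros, so
  the first conclusion compares elements of $J(X)$.\<close>

lemma word_determines:
  assumes "mset (word ks ps) = mset (word ls qs)" "index_sorted ps" "index_sorted qs"
  shows "Y_prod ks = (Y_prod ls :: 'k::field free_jordan)" "ps = qs"
proof -
  have "count (mset (word ks ps)) (Zdiag j) = count (mset (flat ps)) j" for ks ps j
  proof -
    have "count (mset (concat (map (\<lambda>i. replicate (ks ! i) (Ycoord i)) is))) (Zdiag j) = 0" for "is"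
      by (induction "is") auto
    moreover have "count (mset (map Zdiag xs)) (Zdiag j) = count (mset xs) j" for xs
      by (induction xs) auto
    ultimately show ?thesis by (simp add: word_def)
  qed
  then have "mset (flat ps) = mset (flat qs)"
    using assms(1) by (metis multiset_eqI)
  then have "flat ps = flat qs"
    using assms(2,3) unfolding index_sorted_def flat_def by (metis properties_for_sort)
  then show "ps = qs" by (metis pairs_flat)
  have Y: "count (mset (word ks ps)) (Ycoord j) = exponent ks j" for ks ps j
  proof -
    have "count (mset (concat (map (\<lambda>i. replicate (ks ! i) (Ycoord i)) [0..<n]))) (Ycoord j) =
        (if j < n then ks ! j else 0)" for n
      by (induction n) auto
    moreover have "count (mset (map Zdiag xs)) (Ycoord j) = 0" for xs
      by (induction xs) auto
    ultimately show ?thesis by (simp add: word_def exponent_def)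
  qed
  have "exponent ks = exponent ls"
    using Y[of ks ps] Y[of ls qs] assms(1) by (intro ext) metis
  moreover define n where "n = max (length ks) (length ls)"
  have "Y_prod ks = (Y_prod (map (exponent ks) [0..<n]) :: 'k free_jordan)"
    "Y_prod ls = (Y_prod (map (exponent ls) [0..<n]) :: 'k free_jordan)"
    by (simp_all add: Y_prod_pad n_def)
  ultimately show "Y_prod ks = (Y_prod ls :: 'k free_jordan)" by simp
qed

lemma Zoff_notin_word: "Zoff i \<notin> set (word ks ps)"
  by (auto simp: word_def)

text \<open>The values of S are characters of the monoid of coordinate functions under pointwise
  product, and an identity makes a linear combination of them vanish.\<close>

lemma S_Sca_independent_mod_T_Sca:
  assumes inf: "infinite (UNIV :: 'k::field set)" and two: "(2::'k) \<noteq> 0"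
    and F: "finite F" "F \<subseteq> S_Sca" and T: "(\<Sum>s\<in>F. jscale (c s) s) \<in> (T_Sca :: 'k free_jordan set)"
  shows "\<forall>s\<in>F. c s = 0"
proof (rule characters_independent[where ch = "\<lambda>s v. generic_value v s"
      and mul = "\<lambda>v w x. v x * w x" and e = "\<lambda>_. 1"])
  \<comment> \<open>Each value is a monomial in the coordinates, which gives multiplicativity and
    the value 1 at the constant 1.\<close>
  have "\<exists>xs. \<forall>v. generic_value v s = prod_list (map v xs)" if "s \<in> F" for s :: "'k free_jordan"
    using that F(2) generic_value_S[OF two] unfolding S_Sca_def by blast
  then obtain W where W: "\<And>s v. s \<in> F \<Longrightarrow> generic_value v s = prod_list (map v (W s))" by metis
  show "generic_value (\<lambda>x. v x * w x) s = generic_value v s * generic_value w s" if "s \<in> F" for s v w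
  proof -
    have "prod_list (map (\<lambda>x. v x * w x) xs) = prod_list (map v xs) * prod_list (map w xs)" for xs
      by (induction xs) (simp_all add: algebra_simps)
    then show ?thesis by (simp add: W that)
  qed
  show "generic_value (\<lambda>_. 1) s = 1" if "s \<in> F" for s
  proof -
    have "prod_list (map (\<lambda>_. 1) xs) = (1 :: 'k)" for xs :: "coord list"
      by (induction xs) simp_all
    then show ?thesis by (simp add: W that)
  qed
  show "inj_on (\<lambda>s v. generic_value v s) F"
  proof (rule inj_onI)
    fix s t assume st: "s \<in> F" "t \<in> F" and eq: "(\<lambda>v. generic_value v s) = (\<lambda>v. generic_value v t)"
    have V: "mset xs = mset ws" if "\<And>v. generic_value v s = prod_list (map v xs)"
      "\<And>v. generic_value v t = prod_list (map v ws)" for xs ws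
      using monomial_functions_inj[OF inf] that fun_cong[OF eq] by metis
    from st F(2) have "s \<in> S_Sca" "t \<in> S_Sca" by auto
    then consider
      (aa) ks ps ls qs where "s = Y_prod ks * Z_prod ps" "t = Y_prod ls * Z_prod qs"
        "index_sorted ps" "index_sorted qs"
    | (ab) ks ps ls j qs where "s = Y_prod ks * Z_prod ps" "t = Y_prod ls * (z j * Z_prod qs)"
    | (ba) ks i ps ls qs where "s = Y_prod ks * (z i * Z_prod ps)" "t = Y_prod ls * Z_prod qs"
    | (bb) ks i ps ls j qs where "s = Y_prod ks * (z i * Z_prod ps)" "t = Y_prod ls * (z j * Z_prod qs)"
        "index_sorted ps" "index_sorted qs"
      unfolding S_Sca_def by blast
    then show "s = t"
    proof cases
      case aa
      then have "mset (word ks ps) = mset (word ls qs)"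
        by (intro V) (simp_all add: generic_value_S[OF two])
      then show ?thesis using word_determines aa by metis
    next
      case ab
      then have "mset (word ks ps) = mset (Zoff j # word ls qs)"
        by (intro V) (simp_all add: generic_value_S[OF two])
      \<comment> \<open>The letter \<open>Zoff j\<close> occurs on one side only, so the two forms
        never share a character.\<close>
      then have False using Zoff_notin_word by (metis list.set_intros(1) mset_eq_setD)
      then show ?thesis ..
    next
      case ba
      then have "mset (Zoff i # word ks ps) = mset (word ls qs)"
        by (intro V) (simp_all add: generic_value_S[OF two])
      then have False using Zoff_notin_word by (metis list.set_intros(1) mset_eq_setD)
      then show ?thesis ..
    next
      case bb
      then have eq: "mset (Zoff i # word ks ps) = mset (Zoff j # word ls qs)"
        by (intro V) (simp_all add: generic_value_S[OF two])
      \<comment> \<open>Each side carries exactly one \<open>Zoff\<close> letter; it gives i = j and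
        is then cancelled.\<close>
      then have "i = j" using Zoff_notin_word[of i ls qs] by (metis coord.inject(3) list.set_intros(1) mset_eq_setD set_ConsD)
      then show ?thesis using word_determines bb eq by (metis add_mset_add_mset_same_iff mset.simps(2))
    qed
  qed
  have lin: "generic_value v (\<Sum>s\<in>F. jscale (c s) s) = (\<Sum>s\<in>F. c s * generic_value v s)" for v
    using F(1) by (induction F rule: finite_induct)
      (simp_all add: generic_value_def subst_simps two mscale_def Let_def add_divide_distrib algebra_simps)
  show "(\<Sum>s\<in>F. c s * generic_value v s) = 0" for v
    using T graded_generic_assignment[of v] unfolding lin[symmetric]
    by (simp add: generic_value_def T_Sca_iff)
qed (rule F(1))

section \<open>The basis of the quotient and the equality of the two ideals\<close>

lemma coset_sum: "coset (\<Sum>s\<in>F. jscale (c s) s) = (\<Sum>s\<in>F. qscale (c s) (coset s))"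
  by (induction F rule: infinite_finite_induct) (simp_all add: coset_zero coset_simps(3,4))

theorem theorem4p6:
  assumes "infinite (UNIV :: 'k::field set)"
    and "CHAR('k) \<noteq> 2"
  shows "(I_Sca :: 'k free_jordan set) = T_Sca \<and>
         inj_on coset (S_Sca :: 'k free_jordan set) \<and>
         Q.independent (coset ` (S_Sca :: 'k free_jordan set)) \<and>
         Q.span (coset ` (S_Sca :: 'k free_jordan set)) = UNIV"
proof -
  have two: "(2::'k) \<noteq> 0"
  proof
    \<comment> \<open>The characteristic would divide 2; not being 2, it would be 1, which a field
      excludes.\<close>
    assume "(2::'k) = 0"
    then have "CHAR('k) dvd 2" using of_nat_eq_0_iff_char_dvd[of 2, where 'a='k] by simp
    then have "CHAR('k) = 1" using assms(2) by (metis prime_nat_iff two_is_prime_nat)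
    then show False by simp
  qed
  note IT = I_Sca_subset_T_Sca[OF two]
  note indep = S_Sca_independent_mod_T_Sca[OF assms(1) two]
  have inj: "inj_on coset (S_Sca :: 'k free_jordan set)"
  proof (rule inj_onI, rule ccontr)
    fix s t :: "'k free_jordan" assume st: "s \<in> S_Sca" "t \<in> S_Sca" "coset s = coset t" "s \<noteq> t"
    then have "s - t \<in> T_Sca" using IT by (auto simp: coset_simps(1))
    \<comment> \<open>Two members of S with the same class would give the relation s - t, with
      coefficients 1 and -1.\<close>
    then have "(\<Sum>r\<in>{s, t}. jscale (if r = s then 1 else - 1) r) \<in> T_Sca"
      using st by (simp add: J.scale_minus_left)
    from indep[OF _ _ this] st show False by auto
  qed
  \<comment> \<open>Injectivity turns a combination of classes into the class of a combination of
    members of S with the same coefficients.\<close>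
  have lift: "\<exists>F. finite F \<and> F \<subseteq> S_Sca \<and> A = coset ` F \<and>
      (\<Sum>a\<in>A. qscale (u a) a) = coset (\<Sum>s\<in>F. jscale (u (coset s)) s)"
    if A: "finite A" "A \<subseteq> coset ` (S_Sca :: 'k free_jordan set)" for A u
  proof -
    obtain F where F: "F \<subseteq> S_Sca" "finite F" "A = coset ` F"
      using A by (metis finite_subset_image)
    moreover have "inj_on coset F" using inj F(1) by (rule inj_on_subset)
    then have "(\<Sum>a\<in>A. qscale (u a) a) = coset (\<Sum>s\<in>F. jscale (u (coset s)) s)"
      by (simp add: F(3) coset_sum sum.reindex)
    ultimately show ?thesis by blast
  qed
  have "Q.independent (coset ` (S_Sca :: 'k free_jordan set))"
    unfolding Q.dependent_explicit
  proof clarify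
    fix A and u :: "'k quot_Sca \<Rightarrow> 'k" and a
    assume A: "finite A" "A \<subseteq> coset ` S_Sca" and 0: "(\<Sum>a\<in>A. qscale (u a) a) = 0"
      and a: "a \<in> A" "u a \<noteq> 0"
    obtain F where F: "finite F" "F \<subseteq> S_Sca" "A = coset ` F"
      "coset (\<Sum>s\<in>F. jscale (u (coset s)) s) = coset 0"
      using lift[OF A, of u] 0 by (metis coset_zero)
    then have "(\<Sum>s\<in>F. jscale (u (coset s)) s) \<in> T_Sca" using IT by (auto simp: coset_simps(1))
    from indep[OF F(1,2) this] show False using a F(3) by auto
  qed
  moreover have "T_Sca \<subseteq> (I_Sca :: 'k free_jordan set)"
  proof
    fix f :: "'k free_jordan" assume f: "f \<in> T_Sca"
    have "coset f \<in> Q.span (coset ` S_Sca)" by (simp add: coset_S_span)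
    then obtain A u where A: "finite A" "A \<subseteq> coset ` (S_Sca :: 'k free_jordan set)"
      and f_eq: "coset f = (\<Sum>a\<in>A. qscale (u a) a)" unfolding Q.span_explicit by blast
    obtain F where F: "finite F" "F \<subseteq> S_Sca"
      and "coset f = coset (\<Sum>s\<in>F. jscale (u (coset s)) s)"
      using lift[OF A, of u] f_eq by metis
    then have diff: "f - (\<Sum>s\<in>F. jscale (u (coset s)) s) \<in> I_Sca" by (simp add: coset_simps(1))
    \<comment> \<open>Modulo I, f is a combination of members of S. Since I lies in
      \<open>T_Sca\<close>, that combination is an identity too, so its coefficients vanish.\<close>
    have "J.subspace (T_Sca :: 'k free_jordan set)"
      using T_ideal_T_Sca[OF two] by (simp add: T_ideal_def)
    from J.subspace_diff[OF this f subsetD[OF IT diff]]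
    have "(\<Sum>s\<in>F. jscale (u (coset s)) s) \<in> T_Sca" by simp
    from indep[OF F this] diff show "f \<in> I_Sca" by simp
  qed
  ultimately show ?thesis using IT inj coset_S_span by blast
qed

end
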